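(* Let $G$ be a generalized split graph with no antiholes (as induced subgraphs). Then each connected component of $G$ is obtained recursively by gluing along cliques starting from perfectly orderable graphs. In particular, there exists a monomial order on $K[x_1,\dots,x_m]$ such that the initial ideal of the toric ideal $I_G\subset K[x_1,\dots,x_m]$ of the stable set polytope of $G$ is squarefree and quadratic, i.e., generated by squarefree monomials of degree $2$.
   Context: All graphs are finite and simple; $\overline{G}$ denotes the complement of $G$. A clique in a graph is a set of pairwise adjacent vertices. A hole is an induced cycle of length $\ge 5$, and an antihole is the complement of a hole. A graph $G$ is called generalized split if either $G$ or $\overline{G}$ satisfies the following condition: the vertex set of the graph is partitioned into disjoint cliques $C_0,C_1,\dots,C_k$ such that there are no edges between $C_i$ and $C_j$ for any $1\le i<j\le k$. A graph $G$ is obtained by gluing graphs $H_1$ and $H_2$ along their common clique if $H_1\cap H_2$ is a complete graph and $G=H_1\cup H_2$. An ordering $(v_1,\dots,v_n)$ of the vertices of a graph $G$ is called perfect if for any induced subgraph $H$ of $G$ (with the induced ordering of its vertices), the number of colors used by Greedy Coloring on $H$ equals the chromatic number of $H$. Here Greedy Coloring processes the vertices in the given order and assigns to each vertex the smallest positive integer not already assigned to one of its previously colored neighbors. (Equivalently, by a known theorem, a vertex ordering $<$ is perfect if and only if $G$ contains no induced path $P_4$ on four vertices $abcd$, with edges $ab,bc,cd$, such that $a<b$ and $d<c$.) A graph is perfectly orderable if it has a perfect ordering of its vertex set. Let $G$ be a graph on the vertex set $[n]=\{1,\dots,n\}$. A subset $S\subset[n]$ is a stable set of $G$ if no two distinct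 elements of $S$ are adjacent; the empty set and singletons are stable. Let $S(G)=\{S_1,\dots,S_m\}$ be the set of all stable sets of $G$, and put $\rho(S)=\sum_{j\in S}\mathbf{e}_j\in\mathbb{R}^n$, where $\mathbf{e}_j$ is the $j$-th unit coordinate vector. The stable set polytope of $G$ is the convex hull of $\{\rho(S_1),\dots,\rho(S_m)\}$. Let $K$ be a field. The toric ideal $I_G$ of the stable set polytope of $G$ is the kernel of the $K$-algebra homomorphism $\pi_G:K[x_1,\dots,x_m]\to K[t_1,\dots,t_n,s]$ given by $\pi_G(x_i)=\mathbf{t}^{\rho(S_i)}s$, where $\mathbf{t}^{\mathbf{a}}=t_1^{a_1}\cdots t_n^{a_n}$. A monomial order is a total order $<$ on the monomials of $K[x_1,\dots,x_m]$ such that $1$ is the smallest monomial and $u<v$ implies $uw<vw$. The initial ideal of an ideal $I$ is the monomial ideal generated by the initial (largest) monomials of all nonzero elements of $I$. Convention: if $I_G=\{0\}$ (which happens exactly when $G$ is complete), the zero initial ideal counts as squarefree and quadratic. *)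

theory Defs
  imports "HOL-Library.Ramsey" "HOL-Library.Disjoint_Sets" "HOL-Library.Poly_Mapping" "HOL-Algebra.RingHom"
begin

section \<open>Finite simple graphs\<close>

record 'a graph =
  verts :: "'a set"
  edges :: "'a set set"

text \<open>Edges are 2-element sets of vertices. Cliques and stable sets are then given by
  \<^const>\<open>clique\<close> and \<^const>\<open>indep\<close> from the library.\<close>

definition simple_graph :: "'a graph \<Rightarrow> bool" where
  "simple_graph G \<longleftrightarrow> finite (verts G) \<and> edges G \<subseteq> nsets (verts G) 2"

definition adj :: "'a graph \<Rightarrow> 'a \<Rightarrow> 'a \<Rightarrow> bool" where
  "adj G u v \<longleftrightarrow> {u, v} \<in> edges G"

definition graph_complement :: "'a graph \<Rightarrow> 'a graph" where
  "graph_complement G = \<lparr>verts = verts G, edges = nsets (verts G) 2 - edges G\<rparr>"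

definition induced_subgraph :: "'a graph \<Rightarrow> 'a set \<Rightarrow> 'a graph" where
  "induced_subgraph G W = \<lparr>verts = W, edges = {e \<in> edges G. e \<subseteq> W}\<rparr>"

definition graph_union :: "'a graph \<Rightarrow> 'a graph \<Rightarrow> 'a graph" where
  "graph_union G H = \<lparr>verts = verts G \<union> verts H, edges = edges G \<union> edges H\<rparr>"

definition graph_inter :: "'a graph \<Rightarrow> 'a graph \<Rightarrow> 'a graph" where
  "graph_inter G H = \<lparr>verts = verts G \<inter> verts H, edges = edges G \<inter> edges H\<rparr>"

definition complete_graph :: "'a graph \<Rightarrow> bool" where
  "complete_graph G \<longleftrightarrow> clique (verts G) (edges G)"

definition graph_isomorphic :: "'a graph \<Rightarrow> 'b graph \<Rightarrow> bool" where
  "graph_isomorphic G H \<longleftrightarrow>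
     (\<exists>f. bij_betw f (verts G) (verts H) \<and> edges H = (\<lambda>e. f ` e) ` edges G)"

definition connected_components :: "'a graph \<Rightarrow> 'a graph set" where
  "connected_components G =
     (\<lambda>u. induced_subgraph G {v \<in> verts G. (adj G)\<^sup>*\<^sup>* u v}) ` verts G"

definition cycle_graph :: "nat \<Rightarrow> nat graph" where
  "cycle_graph k = \<lparr>verts = {..<k}, edges = (\<lambda>i. {i, Suc i mod k}) ` {..<k}\<rparr>"

text \<open>The predicates \<open>is_hole\<close> and \<open>is_antihole\<close> describe the graph itself; that a hole or an
  antihole sits in another graph as an induced subgraph is expressed with
  \<^const>\<open>induced_subgraph\<close>.\<close>

definition is_hole :: "'a graph \<Rightarrow> bool" where
  "is_hole H \<longleftrightarrow> (\<exists>k\<ge>5. graph_isomorphic H (cycle_graph k))"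

definition is_antihole :: "'a graph \<Rightarrow> bool" where
  "is_antihole H \<longleftrightarrow> is_hole (graph_complement H)"

definition antihole_free :: "'a graph \<Rightarrow> bool" where
  "antihole_free G \<longleftrightarrow> (\<forall>W\<subseteq>verts G. \<not> is_antihole (induced_subgraph G W))"

definition unipolar :: "'a graph \<Rightarrow> bool" where
  "unipolar G \<longleftrightarrow> (\<exists>(k::nat) C.
     (\<Union>i\<le>k. C i) = verts G \<and> disjoint_family_on C {..k} \<and>
     (\<forall>i\<le>k. clique (C i) (edges G)) \<and>
     (\<forall>i j. 1 \<le> i \<and> i < j \<and> j \<le> k \<longrightarrow> (\<forall>u\<in>C i. \<forall>v\<in>C j. \<not> adj G u v)))"

definition generalized_split :: "'a graph \<Rightarrow> bool" where
  "generalized_split G \<longleftrightarrow> unipolar G \<or> unipolar (graph_complement G)"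


section \<open>Perfect orderings\<close>

text \<open>A vertex ordering is a list. Greedy coloring is a fold over it whose state is the partial
  coloring of the vertices processed so far.\<close>

definition greedy_step :: "'a graph \<Rightarrow> ('a \<rightharpoonup> nat) \<Rightarrow> 'a \<Rightarrow> ('a \<rightharpoonup> nat)" where
  "greedy_step G c v = c(v \<mapsto> (LEAST k. 1 \<le> k \<and> (\<forall>u\<in>verts G. adj G u v \<longrightarrow> c u \<noteq> Some k)))"

definition greedy_coloring :: "'a graph \<Rightarrow> 'a list \<Rightarrow> ('a \<rightharpoonup> nat)" where
  "greedy_coloring G vs = foldl (greedy_step G) Map.empty vs"

definition proper_coloring :: "'a graph \<Rightarrow> ('a \<Rightarrow> nat) \<Rightarrow> bool" where
  "proper_coloring G c \<longleftrightarrow> (\<forall>u\<in>verts G. \<forall>v\<in>verts G. adj G u v \<longrightarrow> c u \<noteq> c v)"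

definition chromatic_number :: "'a graph \<Rightarrow> nat" where
  "chromatic_number G = (LEAST k. \<exists>c. proper_coloring G c \<and> c ` verts G \<subseteq> {1..k})"

definition perfect_ordering :: "'a graph \<Rightarrow> 'a list \<Rightarrow> bool" where
  "perfect_ordering G vs \<longleftrightarrow> distinct vs \<and> set vs = verts G \<and>
     (\<forall>W\<subseteq>verts G.
        card (ran (greedy_coloring (induced_subgraph G W) (filter (\<lambda>v. v \<in> W) vs)))
          = chromatic_number (induced_subgraph G W))"

definition perfectly_orderable :: "'a graph \<Rightarrow> bool" where
  "perfectly_orderable G \<longleftrightarrow> (\<exists>vs. perfect_ordering G vs)"


section \<open>Gluing along cliques\<close>

text \<open>The common clique is required to be nonempty: gluing along the empty clique would be a
  disjoint union, and speaking of connected components would be pointless.\<close>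

definition glued_along_clique :: "'a graph \<Rightarrow> 'a graph \<Rightarrow> 'a graph \<Rightarrow> bool" where
  "glued_along_clique G H1 H2 \<longleftrightarrow>
     verts (graph_inter H1 H2) \<noteq> {} \<and> complete_graph (graph_inter H1 H2) \<and> G = graph_union H1 H2"

inductive clique_gluing_of_perfectly_orderable :: "'a graph \<Rightarrow> bool" where
  base: "simple_graph H \<Longrightarrow> perfectly_orderable H \<Longrightarrow> clique_gluing_of_perfectly_orderable H"
| glue: "clique_gluing_of_perfectly_orderable H1 \<Longrightarrow> clique_gluing_of_perfectly_orderable H2 \<Longrightarrow>
         glued_along_clique G H1 H2 \<Longrightarrow> clique_gluing_of_perfectly_orderable G"


section \<open>Polynomial rings and initial ideals\<close>

text \<open>A monomial is given by its exponent vector, of type \<open>'i \<Rightarrow>\<^sub>0 nat\<close>. \<open>poly_ring X\<close> is the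
  polynomial ring over the field \<open>'k\<close> in the variables indexed by \<open>X\<close>.\<close>

type_synonym ('i, 'k) mpoly = "('i \<Rightarrow>\<^sub>0 nat) \<Rightarrow>\<^sub>0 'k"

definition monomials :: "'i set \<Rightarrow> ('i \<Rightarrow>\<^sub>0 nat) set" where
  "monomials X = {u. Poly_Mapping.keys u \<subseteq> X}"

definition poly_ring :: "'i set \<Rightarrow> ('i, 'k::field) mpoly ring" where
  "poly_ring X = \<lparr>carrier = {f. Poly_Mapping.keys f \<subseteq> monomials X},
     mult = (*), one = 1, zero = 0, add = (+)\<rparr>"

definition poly_subst :: "('i \<Rightarrow> ('j, 'k) mpoly) \<Rightarrow> ('i, 'k) mpoly \<Rightarrow> ('j, 'k::field) mpoly" where
  "poly_subst g f = (\<Sum>u\<in>Poly_Mapping.keys f. Poly_Mapping.single 0 (Poly_Mapping.lookup f u) *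
     (\<Prod>i\<in>Poly_Mapping.keys u. g i ^ Poly_Mapping.lookup u i))"

text \<open>\<open>prec\<close> is the strict order; only its restriction to the monomials in the variables \<open>X\<close>
  matters. The unit monomial and the product of monomials are \<open>0\<close> and \<open>+\<close> on exponents.\<close>

definition monomial_order :: "'i set \<Rightarrow> (('i \<Rightarrow>\<^sub>0 nat) \<Rightarrow> ('i \<Rightarrow>\<^sub>0 nat) \<Rightarrow> bool) \<Rightarrow> bool" where
  "monomial_order X prec \<longleftrightarrow>
     irreflp_on (monomials X) prec \<and> transp_on (monomials X) prec \<and>
     totalp_on (monomials X) prec \<and>
     (\<forall>u\<in>monomials X. u \<noteq> 0 \<longrightarrow> prec 0 u) \<and>
     (\<forall>u\<in>monomials X. \<forall>v\<in>monomials X. \<forall>w\<in>monomials X. prec u v \<longrightarrow> prec (u + w) (v + w))"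

definition initial_monomial ::
    "(('i \<Rightarrow>\<^sub>0 nat) \<Rightarrow> ('i \<Rightarrow>\<^sub>0 nat) \<Rightarrow> bool) \<Rightarrow> ('i, 'k::field) mpoly \<Rightarrow> ('i \<Rightarrow>\<^sub>0 nat)" where
  "initial_monomial prec f =
     (THE u. u \<in> Poly_Mapping.keys f \<and> (\<forall>v\<in>Poly_Mapping.keys f. v \<noteq> u \<longrightarrow> prec v u))"

definition monomial_ideal :: "'i set \<Rightarrow> ('i \<Rightarrow>\<^sub>0 nat) set \<Rightarrow> ('i, 'k::field) mpoly set" where
  "monomial_ideal X M = genideal (poly_ring X) ((\<lambda>u. Poly_Mapping.single u 1) ` M)"

definition initial_ideal ::
    "'i set \<Rightarrow> (('i \<Rightarrow>\<^sub>0 nat) \<Rightarrow> ('i \<Rightarrow>\<^sub>0 nat) \<Rightarrow> bool) \<Rightarrow> ('i, 'k::field) mpoly set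
      \<Rightarrow> ('i, 'k) mpoly set" where
  "initial_ideal X prec I = monomial_ideal X (initial_monomial prec ` (I - {0}))"

definition squarefree_monomial :: "('i \<Rightarrow>\<^sub>0 nat) \<Rightarrow> bool" where
  "squarefree_monomial u \<longleftrightarrow> (\<forall>i. Poly_Mapping.lookup u i \<le> 1)"

definition monomial_degree :: "('i \<Rightarrow>\<^sub>0 nat) \<Rightarrow> nat" where
  "monomial_degree u = (\<Sum>i\<in>Poly_Mapping.keys u. Poly_Mapping.lookup u i)"

text \<open>The zero ideal qualifies, with \<open>M = {}\<close>.\<close>

definition squarefree_quadratic :: "'i set \<Rightarrow> ('i, 'k::field) mpoly set \<Rightarrow> bool" where
  "squarefree_quadratic X J \<longleftrightarrow>
     (\<exists>M\<subseteq>monomials X. (\<forall>u\<in>M. squarefree_monomial u \<and> monomial_degree u = 2) \<and>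
        J = monomial_ideal X M)"


section \<open>The toric ideal of the stable set polytope\<close>

text \<open>The variables \<open>x\<^sub>1, \<dots>, x\<^sub>m\<close> are indexed by the stable sets themselves instead of by an
  enumeration of them. In the target ring the index \<open>Some j\<close> stands for \<open>t\<^sub>j\<close> and \<open>None\<close>
  for \<open>s\<close>.\<close>

definition stable_sets :: "'a graph \<Rightarrow> 'a set set" where
  "stable_sets G = {S. S \<subseteq> verts G \<and> indep S (edges G)}"

definition stable_set_monomial :: "'a set \<Rightarrow> ('a option \<Rightarrow>\<^sub>0 nat)" where
  "stable_set_monomial S = (\<Sum>j\<in>S. Poly_Mapping.single (Some j) 1) + Poly_Mapping.single None 1"

definition toric_hom :: "('a set, 'k::field) mpoly \<Rightarrow> ('a option, 'k) mpoly" where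
  "toric_hom = poly_subst (\<lambda>S. Poly_Mapping.single (stable_set_monomial S) 1)"

definition toric_ideal :: "'a graph \<Rightarrow> ('a set, 'k::field) mpoly set" where
  "toric_ideal G =
     a_kernel (poly_ring (stable_sets G)) (poly_ring (insert None (Some ` verts G))) toric_hom"


section \<open>Well-definedness\<close>

lemma monomials_0 [simp]: "0 \<in> monomials X"
  by (simp add: monomials_def)

lemma monomials_add: "u \<in> monomials X \<Longrightarrow> v \<in> monomials X \<Longrightarrow> u + v \<in> monomials X"
  using Poly_Mapping.keys_add[of u v] by (auto simp: monomials_def)

lemma cring_poly_ring: "cring (poly_ring X :: ('i, 'k::field) mpoly ring)"
proof (rule cringI)
  let ?R = "poly_ring X :: ('i, 'k) mpoly ring"
  have add: "f + g \<in> carrier ?R" if "f \<in> carrier ?R" "g \<in> carrier ?R" for f g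
    using that Poly_Mapping.keys_add[of f g] by (auto simp: poly_ring_def)
  have mult: "f * g \<in> carrier ?R" if "f \<in> carrier ?R" "g \<in> carrier ?R" for f g
    using that keys_mult[of f g] by (fastforce simp: poly_ring_def intro: monomials_add)
  have uminus: "- f \<in> carrier ?R" if "f \<in> carrier ?R" for f
    using that by (simp add: poly_ring_def)
  show "abelian_group ?R"
  proof (rule abelian_groupI)
    fix f assume f: "f \<in> carrier ?R"
    show "\<exists>g\<in>carrier ?R. g \<oplus>\<^bsub>?R\<^esub> f = \<zero>\<^bsub>?R\<^esub>"
      by (rule bexI[OF _ uminus[OF f]]) (simp add: poly_ring_def)
  qed (use add in \<open>auto simp: poly_ring_def algebra_simps\<close>)
  show "comm_monoid ?R"
    by (rule comm_monoidI) (use mult in \<open>auto simp: poly_ring_def algebra_simps\<close>)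
qed (auto simp: poly_ring_def algebra_simps)

lemma poly_subst_superset:
  assumes "finite A" "Poly_Mapping.keys f \<subseteq> A"
  shows "poly_subst g f = (\<Sum>u\<in>A. Poly_Mapping.single 0 (Poly_Mapping.lookup f u) *
     (\<Prod>i\<in>Poly_Mapping.keys u. g i ^ Poly_Mapping.lookup u i))"
  unfolding poly_subst_def
  by (rule sum.mono_neutral_left) (use assms in \<open>auto simp: in_keys_iff\<close>)

lemma poly_subst_add: "poly_subst g (f + h) = poly_subst g f + poly_subst g h"
proof -
  let ?A = "Poly_Mapping.keys f \<union> Poly_Mapping.keys h"
  have "Poly_Mapping.keys (f + h) \<subseteq> ?A"
    by (rule Poly_Mapping.keys_add)
  then show ?thesis
    by (simp add: poly_subst_superset[of ?A] lookup_add single_add distrib_right sum.distrib)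
qed

lemma poly_subst_0 [simp]: "poly_subst g 0 = 0"
  by (simp add: poly_subst_def)

lemma poly_subst_sum: "poly_subst g (sum F A) = (\<Sum>a\<in>A. poly_subst g (F a))"
  by (induction A rule: infinite_finite_induct) (auto simp: poly_subst_add)

lemma poly_subst_single: "poly_subst g (Poly_Mapping.single u c) =
    Poly_Mapping.single 0 c * (\<Prod>i\<in>Poly_Mapping.keys u. g i ^ Poly_Mapping.lookup u i)"
  by (cases "c = 0") (auto simp: poly_subst_def)

lemma power_prod_add:
  fixes g :: "'i \<Rightarrow> 'b::comm_semiring_1"
  shows "(\<Prod>i\<in>Poly_Mapping.keys (u + v). g i ^ Poly_Mapping.lookup (u + v) i) =
    (\<Prod>i\<in>Poly_Mapping.keys u. g i ^ Poly_Mapping.lookup u i) *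
    (\<Prod>i\<in>Poly_Mapping.keys v. g i ^ Poly_Mapping.lookup v i)"
proof -
  let ?A = "Poly_Mapping.keys u \<union> Poly_Mapping.keys v"
  have *: "(\<Prod>i\<in>Poly_Mapping.keys w. g i ^ Poly_Mapping.lookup w i) =
      (\<Prod>i\<in>?A. g i ^ Poly_Mapping.lookup w i)" if "Poly_Mapping.keys w \<subseteq> ?A" for w
    by (rule prod.mono_neutral_left) (use that in \<open>auto simp: in_keys_iff\<close>)
  show ?thesis
    using *[OF Poly_Mapping.keys_add[of u v]] *[of u] *[of v]
    by (simp add: lookup_add power_add prod.distrib)
qed

lemma poly_mapping_sum_single:
  "f = (\<Sum>u\<in>Poly_Mapping.keys f. Poly_Mapping.single u (Poly_Mapping.lookup f u))"
  by (rule poly_mapping_eqI) (auto simp: lookup_sum lookup_single when_def in_keys_iff)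

lemma single_0_mult: "Poly_Mapping.single (0::'m::monoid_add) (c * d) =
    Poly_Mapping.single 0 c * Poly_Mapping.single 0 d"
  by (simp add: mult_single)

lemma poly_subst_mult: "poly_subst g (f * h) = poly_subst g f * poly_subst g h"
proof -
  let ?s = "\<lambda>f u. Poly_Mapping.single u (Poly_Mapping.lookup f u)"
  have 1: "poly_subst g (Poly_Mapping.single u c * Poly_Mapping.single v d) =
      poly_subst g (Poly_Mapping.single u c) * poly_subst g (Poly_Mapping.single v d)" for u v c d
    unfolding mult_single
    unfolding poly_subst_single power_prod_add single_0_mult by (simp only: mult_ac)
  have "poly_subst g (f * h) =
      poly_subst g ((\<Sum>u\<in>Poly_Mapping.keys f. ?s f u) * (\<Sum>v\<in>Poly_Mapping.keys h. ?s h v))"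
    by (simp flip: poly_mapping_sum_single)
  also have "\<dots> = poly_subst g (\<Sum>u\<in>Poly_Mapping.keys f. ?s f u) *
      poly_subst g (\<Sum>v\<in>Poly_Mapping.keys h. ?s h v)"
    by (simp add: sum_product poly_subst_sum 1)
  finally show ?thesis
    by (simp flip: poly_mapping_sum_single)
qed

lemma poly_subst_const: "poly_subst g (Poly_Mapping.single 0 c) = Poly_Mapping.single 0 c"
  by (simp add: poly_subst_single)

lemma stable_set_monomial_in_monomials:
  assumes "S \<subseteq> V"
  shows "stable_set_monomial S \<in> monomials (insert None (Some ` V))"
proof -
  have "(\<Sum>j\<in>S. Poly_Mapping.single (Some j) 1) \<in> monomials (insert None (Some ` V))"
    using assms
    by (induction S rule: infinite_finite_induct)
      (auto intro!: monomials_add, auto simp: monomials_def)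
  then show ?thesis
    unfolding stable_set_monomial_def
    by (rule monomials_add) (simp add: monomials_def)
qed

lemma toric_hom_var:
  "toric_hom (Poly_Mapping.single (Poly_Mapping.single S 1) 1) =
     Poly_Mapping.single (stable_set_monomial S) 1"
  by (simp add: toric_hom_def poly_subst_single)

lemma toric_hom_ring_hom:
  "toric_hom \<in> ring_hom (poly_ring (stable_sets G) :: ('a set, 'k::field) mpoly ring)
     (poly_ring (insert None (Some ` verts G)))"
proof (rule ring_hom_memI)
  let ?Y = "insert None (Some ` verts G)"
  let ?R = "poly_ring ?Y :: ('a option, 'k) mpoly ring"
  interpret cring ?R by (rule cring_poly_ring)
  fix f :: "('a set, 'k) mpoly"
  assume f: "f \<in> carrier (poly_ring (stable_sets G))"
  have mult: "p * q \<in> carrier ?R" if "p \<in> carrier ?R" "q \<in> carrier ?R" for p q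
    using m_closed[OF that] by (simp add: poly_ring_def)
  have one: "1 \<in> carrier ?R"
    using one_closed by (simp add: poly_ring_def)
  have pow: "p ^ n \<in> carrier ?R" if "p \<in> carrier ?R" for p n
    by (induction n) (use that mult one in auto)
  have prod: "prod F A \<in> carrier ?R" if "\<And>i. i \<in> A \<Longrightarrow> F i \<in> carrier ?R" for F and A :: "'a set set"
    using that by (induction A rule: infinite_finite_induct) (use mult one in auto)
  have add: "p + q \<in> carrier ?R" if "p \<in> carrier ?R" "q \<in> carrier ?R" for p q
    using a_closed[OF that] by (simp add: poly_ring_def)
  have sum: "sum F A \<in> carrier ?R" if "\<And>i. i \<in> A \<Longrightarrow> F i \<in> carrier ?R"
    for F and A :: "('a set \<Rightarrow>\<^sub>0 nat) set"
    using that
    by (induction A rule: infinite_finite_induct) (use add zero_closed in \<open>auto simp: poly_ring_def\<close>)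
  have var: "Poly_Mapping.single (stable_set_monomial S) 1 \<in> carrier ?R" if "S \<in> stable_sets G" for S
    using that stable_set_monomial_in_monomials[of S "verts G"]
    by (simp add: poly_ring_def stable_sets_def)
  have const: "Poly_Mapping.single 0 c \<in> carrier ?R" for c
    by (simp add: poly_ring_def)
  show "toric_hom f \<in> carrier ?R"
    unfolding toric_hom_def poly_subst_def
    by (intro sum mult const prod pow var) (use f in \<open>auto simp: poly_ring_def monomials_def\<close>)
next
  show "toric_hom \<one>\<^bsub>poly_ring (stable_sets G)\<^esub> = \<one>\<^bsub>poly_ring (insert None (Some ` verts G))\<^esub>"
    using poly_subst_const[of _ 1] by (simp add: toric_hom_def poly_ring_def)
qed (auto simp: toric_hom_def poly_subst_add poly_subst_mult poly_ring_def)

end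

theory Submission
  imports Defs "HOL-Library.Multiset"
begin

text \<open>
  Call a vertex ordering obstruction-free if no induced path \<open>a b c d\<close> has \<open>a\<close> before \<open>b\<close> and \<open>d\<close>
  before \<open>c\<close>. Both conclusions are proved by exhibiting obstruction-free orderings of the pieces
  from which \<open>G\<close> is glued.

  Obstruction-free orderings are perfect (Chvatal). Whenever greedy coloring uses \<open>m\<close> colors, a
  clique with \<open>m\<close> vertices can be grown downwards from color \<open>m\<close>, one color class at a time; the
  step is \<open>obstruction_free_clique_dominated\<close>. See \<open>obstruction_free_imp_perfectly_orderable\<close>.

  Suppose that the complement of \<open>G\<close> is partitioned into cliques \<open>C\<^sub>0, \<dots>, C\<^sub>k\<close>. Then any ordering of
  \<open>G\<close> that puts the stable set \<open>C\<^sub>0\<close> last is obstruction-free (\<open>counipolar_obstruction_free\<close>). If \<open>G\<close>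
  itself is so partitioned, it is glued along \<open>C\<^sub>0\<close> from the subgraphs induced by \<open>C\<^sub>0 \<union> C\<^sub>i\<close>, unless
  \<open>C\<^sub>0\<close> is empty and \<open>G\<close> has no induced path on four vertices at all. A graph covered by two cliques
  is described by the zero-one matrix of nonadjacency between them. Order its rows and columns
  lexically at the same time. An obstruction is then a submatrix with rows \<open>1 1\<close> and \<open>1 0\<close>, and the
  lexical order extends it to a longer and longer zigzag, which by finiteness closes up to a cycle of
  length at least six in the bipartite graph of nonadjacency. This is an antihole
  (\<open>cobipartite_obstruction_free\<close>).

  For the toric ideal, a monomial is a multiset of stable sets, and two monomials have the same image
  when they have the same size and contain every vertex equally often. Give each stable set an integer
  weight and call a multiset pairwise minimal if no two of its members can be exchanged for two stable
  sets of smaller total weight without changing the image. If pairwise minimal multisets are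
  determined by their image (\<open>sorting_weight\<close>), then the nonminimal pairs generate the initial ideal
  for any order refining degree and weight, and such pairs are squarefree because the square of a
  variable is alone in its fiber (\<open>sorting_weight_imp_squarefree_quadratic\<close>). An obstruction-free
  ordering gives such a weight: in a minimal pair one member is the greedy stable set of the union, so
  the leading member of a pairwise minimal multiset is the greedy stable set of its support
  (\<open>sorting_weight_obstruction_free\<close>). A gluing inherits such a weight from its two parts, as a stable
  set meets the common clique in at most one vertex (\<open>sorting_weight_glued\<close>).
\<close>


section \<open>Adjacency and induced subgraphs\<close>

lemma adj_sym: "adj G u v \<longleftrightarrow> adj G v u"
  by (simp add: adj_def insert_commute)

lemma simple_graph_adjD:
  assumes "simple_graph G" "adj G u v"
  shows "u \<in> verts G" "v \<in> verts G" "u \<noteq> v"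
proof -
  have "{u, v} \<in> nsets (verts G) 2"
    using assms unfolding simple_graph_def adj_def by blast
  then show "u \<in> verts G" "v \<in> verts G" "u \<noteq> v"
    by auto
qed

lemma adj_induced_subgraph: "adj (induced_subgraph G W) u v \<longleftrightarrow> u \<in> W \<and> v \<in> W \<and> adj G u v"
  by (auto simp: adj_def induced_subgraph_def)

lemma adj_graph_complement:
  "adj (graph_complement G) u v \<longleftrightarrow> u \<in> verts G \<and> v \<in> verts G \<and> u \<noteq> v \<and> \<not> adj G u v"
  by (auto simp: adj_def graph_complement_def)

lemma simple_graph_complement: "finite (verts G) \<Longrightarrow> simple_graph (graph_complement G)"
  by (auto simp: simple_graph_def graph_complement_def)

lemma simple_graph_induced_subgraph:
  assumes "simple_graph G" "W \<subseteq> verts G"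
  shows "simple_graph (induced_subgraph G W)"
  using assms by (auto simp: simple_graph_def induced_subgraph_def nsets_def dest: finite_subset)

lemma simple_graph_union:
  "simple_graph H1 \<Longrightarrow> simple_graph H2 \<Longrightarrow> simple_graph (graph_union H1 H2)"
  unfolding simple_graph_def graph_union_def
  using nsets_mono[of "verts H1" "verts H1 \<union> verts H2" 2] nsets_mono[of "verts H2" "verts H1 \<union> verts H2" 2]
  by (auto simp del: doubleton_in_nsets_2)

lemma graph_complement_induced_subgraph:
  "W \<subseteq> verts G \<Longrightarrow> graph_complement (induced_subgraph G W) = induced_subgraph (graph_complement G) W"
  by (auto simp: graph_complement_def induced_subgraph_def nsets_def)

lemma induced_subgraph_verts: "simple_graph G \<Longrightarrow> induced_subgraph G (verts G) = G"
proof -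
  assume "simple_graph G"
  then have "{e \<in> edges G. e \<subseteq> verts G} = edges G"
    by (auto simp: simple_graph_def nsets_def)
  then show ?thesis by (simp add: induced_subgraph_def)
qed

lemma induced_subgraph_twice:
  "W' \<subseteq> W \<Longrightarrow> induced_subgraph (induced_subgraph G W) W' = induced_subgraph G W'"
  by (auto simp: induced_subgraph_def)

lemma stable_sets_iff:
  assumes "simple_graph G"
  shows "S \<in> stable_sets G \<longleftrightarrow> S \<subseteq> verts G \<and> (\<forall>u\<in>S. \<forall>v\<in>S. \<not> adj G u v)"
proof -
  have "\<not> adj G u u" for u
    using simple_graph_adjD(3)[OF assms] by blast
  then show ?thesis
    unfolding stable_sets_def indep_def mem_Collect_eq adj_def by metis
qed

lemma finite_stable_sets: "simple_graph G \<Longrightarrow> finite (stable_sets G)"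
  by (rule finite_subset[of _ "Pow (verts G)"]) (auto simp: stable_sets_def simple_graph_def)

lemma finite_stable_set: "simple_graph G \<Longrightarrow> S \<in> stable_sets G \<Longrightarrow> finite S"
  by (auto simp: stable_sets_def simple_graph_def intro: finite_subset)


section \<open>Obstruction-free orderings are perfect\<close>

text \<open>An ordering is given by a rank function \<open>p\<close>, of which only the values on the vertices matter;
  injectivity is assumed separately. In a simple graph the adjacencies and nonadjacencies required of
  \<open>a\<close>, \<open>b\<close>, \<open>c\<close>, \<open>d\<close> force the four vertices to be distinct.\<close>

definition obstruction_free :: "'a graph \<Rightarrow> ('a \<Rightarrow> nat) \<Rightarrow> bool" where
  "obstruction_free G p \<longleftrightarrow>
     (\<forall>a b c d. adj G a b \<and> adj G b c \<and> adj G c d \<and>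
        \<not> adj G a c \<and> \<not> adj G a d \<and> \<not> adj G b d \<longrightarrow> \<not> (p a < p b \<and> p d < p c))"

lemma obstruction_free_induced_subgraph:
  "obstruction_free G p \<Longrightarrow> obstruction_free (induced_subgraph G W) p"
  unfolding obstruction_free_def adj_induced_subgraph by blast

lemma greedy_coloring_snoc:
  "greedy_coloring H (vs @ [v]) = greedy_step H (greedy_coloring H vs) v"
  by (simp add: greedy_coloring_def)

text \<open>Greedy coloring along the order given by \<open>p\<close> is proper, and each vertex sees all smaller
  colors on earlier neighbors.\<close>

lemma greedy_coloring_props:
  assumes H: "simple_graph H" and vs: "sorted_wrt (\<lambda>u v. (p u :: nat) < p v) vs" "set vs \<subseteq> verts H"
  defines "c \<equiv> greedy_coloring H vs"
  shows "dom c = set vs"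
    and "c v = Some k \<Longrightarrow> 1 \<le> k"
    and "c u = Some k \<Longrightarrow> c v = Some k \<Longrightarrow> \<not> adj H u v"
    and "c v = Some k \<Longrightarrow> 1 \<le> j \<Longrightarrow> j < k \<Longrightarrow> \<exists>u. adj H u v \<and> p u < p v \<and> c u = Some j"
proof -
  have "dom c = set vs \<and>
    (\<forall>v k. c v = Some k \<longrightarrow> 1 \<le> k \<and> (\<forall>u. c u = Some k \<longrightarrow> \<not> adj H u v) \<and>
      (\<forall>j. 1 \<le> j \<and> j < k \<longrightarrow> (\<exists>u. adj H u v \<and> p u < p v \<and> c u = Some j)))"
    using vs unfolding c_def
  proof (induction vs rule: rev_induct)
    case Nil
    then show ?case by (simp add: greedy_coloring_def)
  next
    case (snoc x vs)
    let ?c = "greedy_coloring H vs"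
    have earlier: "p u < p x" if "u \<in> set vs" for u
      using snoc.prems(1) that by (simp add: sorted_wrt_append)
    have IH: "dom ?c = set vs"
      "\<And>v k. ?c v = Some k \<Longrightarrow> 1 \<le> k"
      "\<And>u v k. ?c v = Some k \<Longrightarrow> ?c u = Some k \<Longrightarrow> \<not> adj H u v"
      "\<And>v k j. ?c v = Some k \<Longrightarrow> 1 \<le> j \<Longrightarrow> j < k \<Longrightarrow> \<exists>u. adj H u v \<and> p u < p v \<and> ?c u = Some j"
      using snoc by (simp_all add: sorted_wrt_append)
    have x: "x \<notin> set vs" using earlier by blast
    let ?free = "\<lambda>k. 1 \<le> k \<and> (\<forall>u\<in>verts H. adj H u x \<longrightarrow> ?c u \<noteq> Some k)"
    define k0 where "k0 = (LEAST k. ?free k)"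
    have "finite (insert 0 (ran ?c))"
      using IH(1) by (simp add: finite_ran)
    then obtain k where "k \<notin> insert 0 (ran ?c)"
      using ex_new_if_finite infinite_UNIV_nat by blast
    then have "?free k" by (auto simp: ran_def)
    then have free: "?free k0" unfolding k0_def by (rule LeastI)
    have not_free: "\<exists>u. adj H u x \<and> ?c u = Some j" if "1 \<le> j" "j < k0" for j
      using not_less_Least[of j ?free] that unfolding k0_def by blast
    have c: "greedy_coloring H (vs @ [x]) = ?c(x \<mapsto> k0)"
      by (simp add: greedy_coloring_snoc greedy_step_def k0_def)
    have nx: "\<not> adj H x x" using simple_graph_adjD(3)[OF H] by blast
    have colored: "?c u = Some k \<Longrightarrow> u \<in> set vs" for u k using IH(1) by blast
    have sym: "adj H u v \<longleftrightarrow> adj H v u" for u v by (rule adj_sym)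
    have ne: "?c u = Some k \<Longrightarrow> u \<noteq> x" for u k using colored x by blast
    have free': "\<not> adj H u x" if "?c u = Some k0" for u
      using free that simple_graph_adjD(1)[OF H] by blast
    have free'': "\<not> adj H x u" if "?c u = Some k0" for u
      using free'[OF that] sym by blast
    show ?case
      unfolding c
    proof (intro conjI allI impI)
      show "dom (?c(x \<mapsto> k0)) = set (vs @ [x])" using IH(1) by auto
    next
      fix v k assume "(?c(x \<mapsto> k0)) v = Some k"
      then show "1 \<le> k" using IH(2) free by (auto split: if_splits)
    next
      fix v k u assume "(?c(x \<mapsto> k0)) v = Some k" "(?c(x \<mapsto> k0)) u = Some k"
      then show "\<not> adj H u v"
        using IH(3)[of v k u] free'[of u] free''[of v] nx by (cases "u = x"; cases "v = x") auto
    next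
      fix v k j assume v: "(?c(x \<mapsto> k0)) v = Some k" and j: "1 \<le> j \<and> j < k"
      show "\<exists>u. adj H u v \<and> p u < p v \<and> (?c(x \<mapsto> k0)) u = Some j"
      proof (cases "v = x")
        case True
        then have "j < k0" using v j by simp
        then obtain u where "adj H u x" "?c u = Some j" using not_free j by blast
        then show ?thesis using True earlier[OF colored] ne by (intro exI[of _ u]) auto
      next
        case False
        then obtain u where "adj H u v" "p u < p v" "?c u = Some j" using IH(4)[of v k j] v j by auto
        then show ?thesis using ne[of u j] by (intro exI[of _ u]) auto
      qed
    qed
  qed
  then show "dom c = set vs"
    and "c v = Some k \<Longrightarrow> 1 \<le> k"
    and "c u = Some k \<Longrightarrow> c v = Some k \<Longrightarrow> \<not> adj H u v"
    and "c v = Some k \<Longrightarrow> 1 \<le> j \<Longrightarrow> j < k \<Longrightarrow> \<exists>u. adj H u v \<and> p u < p v \<and> c u = Some j"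
    by blast+
qed

text \<open>Chvatal's lemma: if every vertex \<open>w\<close> of a clique has an earlier neighbor \<open>f w\<close>, and these
  neighbors form a stable set, then one of them is adjacent to the whole clique.\<close>

lemma obstruction_free_clique_dominated:
  assumes free: "obstruction_free G p" and fin: "finite Q" and ne: "Q \<noteq> {}"
    and clique: "\<And>u v. u \<in> Q \<Longrightarrow> v \<in> Q \<Longrightarrow> u \<noteq> v \<Longrightarrow> adj G u v"
    and f: "\<And>w. w \<in> Q \<Longrightarrow> adj G (f w) w \<and> p (f w) < p w"
    and stable: "\<And>u v. u \<in> Q \<Longrightarrow> v \<in> Q \<Longrightarrow> \<not> adj G (f u) (f v)"
  shows "\<exists>w\<in>Q. \<forall>v\<in>Q. adj G (f w) v"
  using fin ne clique f stable
proof (induction "card Q" arbitrary: Q)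
  case 0
  then show ?case by simp
next
  case (Suc n)
  note clique = Suc.prems(3) and f = Suc.prems(4) and stable = Suc.prems(5)
  show ?case
  proof (rule ccontr)
    assume no: "\<not> ?case"
    have ex: "\<exists>w'\<in>Q. w' \<noteq> w \<and> (\<forall>v\<in>Q - {w}. adj G (f w') v) \<and> \<not> adj G (f w') w" if "w \<in> Q" for w
    proof -
      have "Q \<noteq> {w}"
        using no f that by auto
      then have "Q - {w} \<noteq> {}" using that by blast
      moreover have "n = card (Q - {w})" using Suc.hyps(2) that Suc.prems(1) by simp
      ultimately have "\<exists>w'\<in>Q - {w}. \<forall>v\<in>Q - {w}. adj G (f w') v"
        using Suc.prems(1) clique f stable by (intro Suc.hyps(1)) auto
      then show ?thesis using no by blast
    qed
    have "finite (p ` Q)" "p ` Q \<noteq> {}" using Suc.prems by auto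
    then obtain w where w: "w \<in> Q" "p w = Max (p ` Q)"
      using Max_in by (metis (no_types, lifting) imageE)
    have max: "p v \<le> p w" if "v \<in> Q" for v using w Suc.prems(1) that by simp
    obtain v where v: "v \<in> Q" "v \<noteq> w" "\<forall>u\<in>Q - {w}. adj G (f v) u" "\<not> adj G (f v) w"
      using ex[OF w(1)] by blast
    obtain u where u: "u \<in> Q" "u \<noteq> v" "\<forall>t\<in>Q - {v}. adj G (f u) t" "\<not> adj G (f u) v"
      using ex[OF v(1)] by blast
    \<comment> \<open>The path \<open>f v, v, w, f u\<close> is an obstruction, because \<open>w\<close> comes last in \<open>Q\<close>.\<close>
    have "adj G (f v) v" "adj G v w" "adj G w (f u)"
      using f v clique w u adj_sym[of G w "f u"] by auto
    moreover have "\<not> adj G (f v) w" "\<not> adj G (f v) (f u)" "\<not> adj G v (f u)"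
      using v u stable adj_sym[of G v "f u"] by auto
    moreover have "p (f v) < p v" "p (f u) < p w"
      using f v u max[OF u(1)] by fastforce+
    ultimately show False
      using free unfolding obstruction_free_def by blast
  qed
qed

text \<open>On an obstruction-free ordering, greedy coloring with \<open>m\<close> colors is certified to be optimal
  by a clique with \<open>m\<close> vertices.\<close>

lemma greedy_optimal:
  assumes H: "simple_graph H" and free: "obstruction_free H p"
    and vs: "sorted_wrt (\<lambda>u v. p u < p v) vs" "set vs = verts H"
  shows "card (ran (greedy_coloring H vs)) = chromatic_number H"
proof -
  define c where "c = greedy_coloring H vs"
  note props = greedy_coloring_props[OF H vs(1) eq_refl[OF vs(2)], folded c_def]
  have finV: "finite (verts H)" using H by (simp add: simple_graph_def)
  have dom: "dom c = verts H" using props(1) vs(2) by simp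
  have fin: "finite (ran c)" using dom finV by (simp add: finite_ran)
  define m where "m = (if ran c = {} then 0 else Max (ran c))"
  have le_m: "k \<le> m" if "k \<in> ran c" for k
    using that fin by (auto simp: m_def)
  have ran: "ran c = {1..m}"
  proof
    show "ran c \<subseteq> {1..m}" using props(2) le_m by (fastforce simp: ran_def)
    show "{1..m} \<subseteq> ran c"
    proof
      fix j assume j: "j \<in> {1..m}"
      then have "m \<in> ran c" using fin Max_in[of "ran c"] by (auto simp: m_def split: if_splits)
      then obtain v where "c v = Some m" by (auto simp: ran_def)
      then show "j \<in> ran c"
        using props(4)[of v m j] j \<open>m \<in> ran c\<close> by (cases "j = m") (auto intro: ranI)
    qed
  qed
  \<comment> \<open>The colors above \<open>m - n\<close> are represented by a clique; \<open>n\<close> grows until all are.\<close>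
  have ex_clique: "\<exists>Q\<subseteq>verts H. clique Q (edges H) \<and> c ` Q = Some ` {m - n <.. m}" if "n \<le> m" for n
    using that
  proof (induction n)
    case 0
    then show ?case by (intro exI[of _ "{}"]) auto
  next
    case (Suc n)
    then obtain Q where Q: "Q \<subseteq> verts H" "clique Q (edges H)" "c ` Q = Some ` {m - n <.. m}" by auto
    let ?i = "m - n"
    have i: "1 \<le> ?i" "?i \<le> m" using Suc.prems by auto
    have ins: "{m - Suc n <.. m} = insert ?i {m - n <.. m}" using Suc.prems by auto
    have "\<exists>v\<in>verts H. c v = Some ?i \<and> (\<forall>w\<in>Q. adj H v w)"
    proof (cases "Q = {}")
      case True
      have "?i \<in> ran c" using i ran by auto
      then obtain v where "c v = Some ?i" by (auto simp: ran_def)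
      then show ?thesis using True dom by blast
    next
      case False
      have "\<exists>u. adj H u w \<and> p u < p w \<and> c u = Some ?i" if "w \<in> Q" for w
      proof -
        have "c w \<in> Some ` {m - n <.. m}" using Q(3) that by blast
        then obtain k where "c w = Some k" "?i < k" by auto
        then show ?thesis using props(4) i by blast
      qed
      then obtain f where f: "\<And>w. w \<in> Q \<Longrightarrow> adj H (f w) w \<and> p (f w) < p w \<and> c (f w) = Some ?i"
        by metis
      have "\<exists>w\<in>Q. \<forall>v\<in>Q. adj H (f w) v"
      proof (rule obstruction_free_clique_dominated[OF free _ False])
        show "finite Q" using Q(1) finV finite_subset by blast
        show "adj H u v" if "u \<in> Q" "v \<in> Q" "u \<noteq> v" for u v
          using Q(2) that by (auto simp: clique_def adj_def)
        show "\<not> adj H (f u) (f v)" if "u \<in> Q" "v \<in> Q" for u v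
          using props(3) f that by blast
      qed (use f in blast)
      then obtain w where "w \<in> Q" "\<forall>v\<in>Q. adj H (f w) v" by blast
      then show ?thesis using f dom by blast
    qed
    then obtain v where v: "v \<in> verts H" "c v = Some ?i" "\<forall>w\<in>Q. adj H v w" by blast
    have "clique (insert v Q) (edges H)"
      using Q(2) v(3) by (auto simp: clique_def adj_def insert_commute)
    moreover have "c ` insert v Q = Some ` {m - Suc n <.. m}"
      unfolding ins using Q(3) v(2) by simp
    ultimately show ?case
      using Q(1) v(1) by (intro exI[of _ "insert v Q"]) simp
  qed
  have "{m - m <.. m} = {1..m}" by auto
  then obtain Q where Q: "Q \<subseteq> verts H" "clique Q (edges H)" "c ` Q = Some ` {1..m}"
    using ex_clique[of m] by auto
  have finQ: "finite Q" using Q(1) finV finite_subset by blast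
  have cardQ: "m \<le> card Q"
  proof -
    have "card (c ` Q) = m" by (simp add: Q(3) card_image)
    then show ?thesis using card_image_le[OF finQ, of c] by simp
  qed
  have "chromatic_number H = m"
    unfolding chromatic_number_def
  proof (rule Least_equality)
    let ?d = "\<lambda>v. the (c v)"
    have "proper_coloring H ?d"
      unfolding proper_coloring_def
    proof (intro ballI impI)
      fix u v assume "u \<in> verts H" "v \<in> verts H" "adj H u v"
      moreover from this obtain k l where "c u = Some k" "c v = Some l" using dom by blast
      ultimately show "the (c u) \<noteq> the (c v)" using props(3)[of u k v] by auto
    qed
    moreover have "?d ` verts H \<subseteq> {1..m}"
      using ran dom by (force simp: ran_def)
    ultimately show "\<exists>d. proper_coloring H d \<and> d ` verts H \<subseteq> {1..m}" by blast
  next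
    fix k assume "\<exists>d. proper_coloring H d \<and> d ` verts H \<subseteq> {1..k}"
    then obtain d where d: "proper_coloring H d" "d ` verts H \<subseteq> {1..k}" by blast
    have "inj_on d Q"
    proof (rule inj_onI, rule ccontr)
      fix u v assume "u \<in> Q" "v \<in> Q" "d u = d v" "u \<noteq> v"
      moreover from this have "adj H u v" using Q(2) by (simp add: clique_def adj_def)
      ultimately show False using d(1) Q(1) unfolding proper_coloring_def by blast
    qed
    then have "card Q \<le> card {1..k}"
      by (rule card_inj_on_le) (use d(2) Q(1) in auto)
    then show "m \<le> k" using cardQ by simp
  qed
  then show ?thesis using ran by (simp add: c_def)
qed

theorem obstruction_free_imp_perfectly_orderable:
  assumes G: "simple_graph G" and inj: "inj_on p (verts G)" and free: "obstruction_free G p"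
  shows "perfectly_orderable G"
proof -
  have "finite (verts G)" using G by (simp add: simple_graph_def)
  then obtain xs where xs: "set xs = verts G" "distinct xs"
    using finite_distinct_list by blast
  let ?vs = "sort_key p xs"
  have "distinct (map p ?vs)" using xs inj by (simp add: distinct_map)
  then have "sorted_wrt (<) (map p ?vs)" by (simp add: strict_sorted_iff)
  then have sorted: "sorted_wrt (\<lambda>u v. p u < p v) ?vs" by (simp add: sorted_wrt_map)
  have "perfect_ordering G ?vs"
    unfolding perfect_ordering_def
  proof (intro conjI allI impI)
    fix W assume W: "W \<subseteq> verts G"
    show "card (ran (greedy_coloring (induced_subgraph G W) (filter (\<lambda>v. v \<in> W) ?vs))) =
        chromatic_number (induced_subgraph G W)"
    proof (rule greedy_optimal)
      show "simple_graph (induced_subgraph G W)" by (rule simple_graph_induced_subgraph[OF G W])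
      show "obstruction_free (induced_subgraph G W) p"
        by (rule obstruction_free_induced_subgraph[OF free])
      show "sorted_wrt (\<lambda>u v. p u < p v) (filter (\<lambda>v. v \<in> W) ?vs)"
        using sorted by (rule sorted_wrt_filter)
      show "set (filter (\<lambda>v. v \<in> W) ?vs) = verts (induced_subgraph G W)"
        using W xs by (auto simp: induced_subgraph_def)
    qed
  qed (use xs in auto)
  then show ?thesis unfolding perfectly_orderable_def by blast
qed


section \<open>Binary values of finite sets\<close>

text \<open>The set \<open>A\<close> is read as a binary number with the digit of \<open>v\<close> at position \<open>q v\<close>.\<close>

definition binary_value :: "('a \<Rightarrow> nat) \<Rightarrow> 'a set \<Rightarrow> nat" where
  "binary_value q A = (\<Sum>v\<in>A. 2 ^ q v)"

lemma sum_pow2_lessThan: "(\<Sum>i<n. 2 ^ i) < (2::nat) ^ n"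
  by (induction n) auto

lemma binary_value_less:
  assumes fin: "finite A" "finite B" and inj: "inj_on q (A \<union> B)"
    and y: "y \<in> B" "y \<notin> A"
    and agree: "\<And>z. z \<in> A \<union> B \<Longrightarrow> q y < q z \<Longrightarrow> z \<in> A \<longleftrightarrow> z \<in> B"
  shows "binary_value q A < binary_value q B"
proof -
  let ?H = "{z \<in> A. q y < q z}" and ?L = "{z \<in> A. q z < q y}"
  have ne: "q z \<noteq> q y" if "z \<in> A" for z
    using that inj y by (auto simp: inj_on_def)
  then have A: "A = ?H \<union> ?L"
    by (auto simp: nat_neq_iff)
  have "binary_value q ?L = (\<Sum>i\<in>q ` ?L. 2 ^ i)"
    unfolding binary_value_def using inj
    by (subst sum.reindex) (auto simp: inj_on_def)
  also have "\<dots> \<le> (\<Sum>i<q y. 2 ^ i)"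
    by (rule sum_mono2) auto
  also have "\<dots> < 2 ^ q y"
    by (rule sum_pow2_lessThan)
  finally have L: "binary_value q ?L < 2 ^ q y" .
  have "binary_value q A = binary_value q ?H + binary_value q ?L"
    unfolding binary_value_def by (subst A, rule sum.union_disjoint) (use fin in auto)
  also have "\<dots> < binary_value q ?H + 2 ^ q y"
    using L by simp
  also have "\<dots> = binary_value q (insert y ?H)"
    unfolding binary_value_def using fin by simp
  also have "\<dots> \<le> binary_value q B"
    unfolding binary_value_def by (rule sum_mono2) (use fin y agree in auto)
  finally show ?thesis .
qed

lemma binary_value_le_imp:
  assumes fin: "finite A" "finite B" and inj: "inj_on q (A \<union> B)"
    and le: "binary_value q A \<le> binary_value q B" and ne: "A \<noteq> B"
  obtains y where "y \<in> B" "y \<notin> A" "\<And>z. z \<in> A \<union> B \<Longrightarrow> q y < q z \<Longrightarrow> z \<in> A \<longleftrightarrow> z \<in> B"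
proof -
  let ?D = "(A - B) \<union> (B - A)"
  have "finite (q ` ?D)" "q ` ?D \<noteq> {}"
    using fin ne by auto
  then obtain y where y: "y \<in> ?D" "q y = Max (q ` ?D)"
    using Max_in[of "q ` ?D"] by (metis (no_types, lifting) imageE)
  have max: "z \<in> A \<longleftrightarrow> z \<in> B" if "z \<in> A \<union> B" "q y < q z" for z
    using Max_ge[OF \<open>finite (q ` ?D)\<close>, of "q z"] that y by (metis DiffI UnCI imageI leD)
  have "y \<in> B"
  proof (rule ccontr)
    assume "y \<notin> B"
    then have "binary_value q B < binary_value q A"
      using y inj max by (intro binary_value_less[OF fin(2,1), of q y]) (auto simp: Un_commute)
    then show False using le by simp
  qed
  then show thesis
    using that y max by blast
qed

lemma binary_value_inj:
  assumes "finite A" "finite B" "inj_on q (A \<union> B)" "binary_value q A = binary_value q B"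
  shows "A = B"
proof (rule ccontr)
  assume ne: "A \<noteq> B"
  obtain y where "y \<in> B" "y \<notin> A" "\<And>z. z \<in> A \<union> B \<Longrightarrow> q y < q z \<Longrightarrow> z \<in> A \<longleftrightarrow> z \<in> B"
    using binary_value_le_imp[OF assms(1-3) _ ne] assms(4) by auto
  then have "binary_value q A < binary_value q B"
    by (intro binary_value_less[OF assms(1-3)])
  then show False using assms(4) by simp
qed


section \<open>Doubly lexical orderings\<close>

text \<open>If \<open>p\<close> maximizes the sum of \<open>r x\<close> weighted by powers of two, then \<open>r\<close> is monotone along \<open>p\<close>:
  otherwise swapping two values of \<open>p\<close> would increase the sum.\<close>

lemma max_weighted_sum_mono:
  fixes r :: "'a \<Rightarrow> nat" and n :: nat
  assumes fin: "finite X" and p: "inj_on p X" "p ` X \<subseteq> {..<n}"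
    and max: "\<And>p'. inj_on p' X \<Longrightarrow> p' ` X \<subseteq> {..<n} \<Longrightarrow>
      (\<Sum>x\<in>X. 2 ^ p' x * r x) \<le> (\<Sum>x\<in>X. 2 ^ p x * r x)"
    and x: "x \<in> X" "x' \<in> X" "p x < p x'"
  shows "r x \<le> r x'"
proof (rule ccontr)
  assume less: "\<not> ?thesis"
  let ?p = "p(x := p x', x' := p x)"
  have ne: "x \<noteq> x'" using x by auto
  have "inj_on ?p X"
    using p(1) x ne by (auto simp: inj_on_def)
  moreover have "?p ` X \<subseteq> {..<n}"
    using p(2) x by auto
  ultimately have le: "(\<Sum>z\<in>X. 2 ^ ?p z * r z) \<le> (\<Sum>z\<in>X. 2 ^ p z * r z)"
    by (rule max)
  have split: "(\<Sum>z\<in>X. g z) = g x + g x' + (\<Sum>z\<in>X - {x, x'}. g z)" for g :: "'a \<Rightarrow> nat"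
  proof -
    have "X = insert x (insert x' (X - {x, x'}))" using x by auto
    then show ?thesis
      using fin ne by (metis (no_types, lifting) Diff_iff add.assoc finite_Diff finite_insert insertCI insert_iff sum.insert)
  qed
  have "(\<Sum>z\<in>X - {x, x'}. 2 ^ ?p z * r z) = (\<Sum>z\<in>X - {x, x'}. 2 ^ p z * r z)"
    by (rule sum.cong) auto
  then have "2 ^ p x' * r x + 2 ^ p x * r x' \<le> 2 ^ p x * r x + 2 ^ p x' * r x'"
    using le ne unfolding split by simp
  moreover have "2 ^ p x * r x + 2 ^ p x' * r x' < 2 ^ p x' * r x + 2 ^ p x * r x'"
  proof -
    obtain d where d: "r x = r x' + d" "0 < d" using less by (metis less_imp_add_positive not_le)
    have "(2::nat) ^ p x * d < 2 ^ p x' * d" using x(3) d by simp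
    then show ?thesis by (simp add: d(1) algebra_simps)
  qed
  ultimately show False by simp
qed

text \<open>Two rows of a zero-one matrix that differ are compared at the last column where they do: the
  earlier row has a zero there.\<close>

definition rows_lexical :: "'a set \<Rightarrow> 'b set \<Rightarrow> ('a \<Rightarrow> 'b \<Rightarrow> bool) \<Rightarrow> ('a \<Rightarrow> nat) \<Rightarrow> ('b \<Rightarrow> nat) \<Rightarrow> bool" where
  "rows_lexical X Y R p q \<longleftrightarrow>
     (\<forall>x\<in>X. \<forall>x'\<in>X. \<forall>y\<in>Y. p x < p x' \<and> R x y \<and> \<not> R x' y \<longrightarrow>
        (\<exists>z\<in>Y. q y < q z \<and> \<not> R x z \<and> R x' z \<and> (\<forall>t\<in>Y. q z < q t \<longrightarrow> R x t = R x' t)))"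

lemma rows_lexicalI:
  assumes fin: "finite Y" and q: "inj_on q Y"
    and mono: "\<And>x x'. x \<in> X \<Longrightarrow> x' \<in> X \<Longrightarrow> p x < p x' \<Longrightarrow>
      binary_value q {y \<in> Y. R x y} \<le> binary_value q {y \<in> Y. R x' y}"
  shows "rows_lexical X Y R p q"
  unfolding rows_lexical_def
proof (intro ballI impI)
  fix x x' y assume x: "x \<in> X" "x' \<in> X" and y: "y \<in> Y" "p x < p x' \<and> R x y \<and> \<not> R x' y"
  let ?A = "{y \<in> Y. R x y}" and ?B = "{y \<in> Y. R x' y}"
  have fins: "finite ?A" "finite ?B" using fin by auto
  have inj: "inj_on q (?A \<union> ?B)" by (rule inj_on_subset[OF q]) auto
  have le: "binary_value q ?A \<le> binary_value q ?B" using mono x y by blast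
  have ne: "?A \<noteq> ?B" using y by blast
  obtain z where z: "z \<in> ?B" "z \<notin> ?A"
    "\<And>t. t \<in> ?A \<union> ?B \<Longrightarrow> q z < q t \<Longrightarrow> t \<in> ?A \<longleftrightarrow> t \<in> ?B"
    using binary_value_le_imp[OF fins inj le ne] by blast
  have "q y \<noteq> q z" using q y z by (auto simp: inj_on_def)
  moreover have "\<not> q z < q y" using z(3)[of y] y by auto
  ultimately have "q y < q z" by simp
  then show "\<exists>z\<in>Y. q y < q z \<and> \<not> R x z \<and> R x' z \<and> (\<forall>t\<in>Y. q z < q t \<longrightarrow> R x t = R x' t)"
    using z by blast
qed

text \<open>Rows and columns can be ordered lexically at the same time: take positions that maximize the
  sum of \<open>2 ^ (p x + q y)\<close> over all one-entries.\<close>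

lemma ex_doubly_lexical:
  fixes R :: "'a \<Rightarrow> 'b \<Rightarrow> bool"
  assumes X: "finite X" and Y: "finite Y"
  obtains p q where "inj_on p X" "inj_on q Y"
    "rows_lexical X Y R p q" "rows_lexical Y X (\<lambda>y x. R x y) q p"
proof -
  let ?m = "card X" and ?n = "card Y"
  define \<Phi> where "\<Phi> = (\<lambda>(p, q). \<Sum>x\<in>X. \<Sum>y\<in>Y. if R x y then 2 ^ p x * 2 ^ q y else (0::nat))"
  define P where "P = (\<lambda>(p, q). inj_on p X \<and> p ` X \<subseteq> {..<?m} \<and> inj_on q Y \<and> q ` Y \<subseteq> {..<?n})"
  obtain p0 where p0: "inj_on p0 X" "p0 ` X = {0..<?m}"
    using ex_bij_betw_finite_nat[OF X] by (auto simp: bij_betw_def)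
  obtain q0 where q0: "inj_on q0 Y" "q0 ` Y = {0..<?n}"
    using ex_bij_betw_finite_nat[OF Y] by (auto simp: bij_betw_def)
  have "P (p0, q0)" using p0 q0 by (auto simp: P_def)
  moreover have "\<forall>z. P z \<longrightarrow> \<Phi> z < Suc (\<Sum>x\<in>X. \<Sum>y\<in>Y. 2 ^ ?m * 2 ^ ?n)"
  proof (intro allI impI)
    fix z :: "('a \<Rightarrow> nat) \<times> ('b \<Rightarrow> nat)"
    assume "P z"
    moreover obtain p q where z: "z = (p, q)" by force
    ultimately have "p x < ?m" "q y < ?n" if "x \<in> X" "y \<in> Y" for x y
      using that by (auto simp: P_def)
    then show "\<Phi> z < Suc (\<Sum>x\<in>X. \<Sum>y\<in>Y. 2 ^ ?m * 2 ^ ?n)"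
      unfolding z \<Phi>_def prod.case less_Suc_eq_le
      by (intro sum_mono) (auto intro!: mult_le_mono simp: less_imp_le)
  qed
  ultimately obtain z where z: "P z" "\<And>z'. P z' \<Longrightarrow> \<Phi> z' \<le> \<Phi> z"
    using ex_has_greatest_nat[of P "(p0, q0)" \<Phi>] by blast
  obtain p q where pq: "z = (p, q)" by force
  have p: "inj_on p X" "p ` X \<subseteq> {..<?m}" and q: "inj_on q Y" "q ` Y \<subseteq> {..<?n}"
    using z(1) by (auto simp: P_def pq)
  have rows: "\<Phi> (p', q') = (\<Sum>x\<in>X. 2 ^ p' x * binary_value q' {y \<in> Y. R x y})" for p' q'
    unfolding \<Phi>_def prod.case binary_value_def
    using Y by (intro sum.cong refl) (auto simp: sum_distrib_left sum.inter_filter intro!: sum.cong)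
  have cols: "\<Phi> (p', q') = (\<Sum>y\<in>Y. 2 ^ q' y * binary_value p' {x \<in> X. R x y})" for p' q'
    unfolding \<Phi>_def prod.case binary_value_def sum.swap[of _ Y X]
    using X by (intro sum.cong refl) (auto simp: sum_distrib_left sum.inter_filter mult.commute intro!: sum.cong)
  have "rows_lexical X Y R p q"
  proof (rule rows_lexicalI[OF Y q(1)])
    fix x x' assume "x \<in> X" "x' \<in> X" "p x < p x'"
    moreover have "(\<Sum>x\<in>X. 2 ^ p' x * binary_value q {y \<in> Y. R x y}) \<le>
        (\<Sum>x\<in>X. 2 ^ p x * binary_value q {y \<in> Y. R x y})"
      if "inj_on p' X" "p' ` X \<subseteq> {..<?m}" for p'
      using z(2)[of "(p', q)"] that q by (simp add: P_def pq rows)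
    ultimately show "binary_value q {y \<in> Y. R x y} \<le> binary_value q {y \<in> Y. R x' y}"
      using max_weighted_sum_mono[OF X p, of "\<lambda>x. binary_value q {y \<in> Y. R x y}"] by blast
  qed
  moreover have "rows_lexical Y X (\<lambda>y x. R x y) q p"
  proof (rule rows_lexicalI[OF X p(1)])
    fix y y' assume "y \<in> Y" "y' \<in> Y" "q y < q y'"
    moreover have "(\<Sum>y\<in>Y. 2 ^ q' y * binary_value p {x \<in> X. R x y}) \<le>
        (\<Sum>y\<in>Y. 2 ^ q y * binary_value p {x \<in> X. R x y})"
      if "inj_on q' Y" "q' ` Y \<subseteq> {..<?n}" for q'
      using z(2)[of "(p, q')"] that p by (simp add: P_def pq cols)
    ultimately show "binary_value p {x \<in> X. R x y} \<le> binary_value p {x \<in> X. R x y'}"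
      using max_weighted_sum_mono[OF Y q, of "\<lambda>y. binary_value p {x \<in> X. R x y}"] by blast
  qed
  ultimately show thesis using that p q by blast
qed


section \<open>Forbidden submatrices and long cycles\<close>

text \<open>Rows \<open>r 0, \<dots>, r n\<close> and columns \<open>c 0, \<dots>, c n\<close> in increasing order. Their one-entries are those
  at \<open>(0, 0)\<close> and next to the diagonal, so that they form a path. The last two conditions record that
  two consecutive rows or columns do not differ beyond the place where the lexical order compares
  them.\<close>

definition zigzag :: "'a set \<Rightarrow> 'b set \<Rightarrow> ('a \<Rightarrow> 'b \<Rightarrow> bool) \<Rightarrow> ('a \<Rightarrow> nat) \<Rightarrow> ('b \<Rightarrow> nat) \<Rightarrow>
    (nat \<Rightarrow> 'a) \<Rightarrow> (nat \<Rightarrow> 'b) \<Rightarrow> nat \<Rightarrow> bool" where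
  "zigzag X Y R p q r c n \<longleftrightarrow>
     (\<forall>i\<le>n. r i \<in> X \<and> c i \<in> Y) \<and>
     (\<forall>i j. i < j \<and> j \<le> n \<longrightarrow> p (r i) < p (r j) \<and> q (c i) < q (c j)) \<and>
     (\<forall>i j. i \<le> n \<and> j \<le> n \<longrightarrow> (R (r i) (c j) \<longleftrightarrow> i = Suc j \<or> j = Suc i \<or> (i = 0 \<and> j = 0))) \<and>
     (\<forall>i. i + 2 \<le> n \<longrightarrow> (\<forall>y\<in>Y. q (c (i + 2)) < q y \<longrightarrow> R (r i) y = R (r (i + 1)) y)) \<and>
     (\<forall>i. i + 2 \<le> n \<longrightarrow> (\<forall>x\<in>X. p (r (i + 2)) < p x \<longrightarrow> R x (c i) = R x (c (i + 1))))"

lemma zigzag_sym: "zigzag X Y R p q r c n \<Longrightarrow> zigzag Y X (\<lambda>y x. R x y) q p c r n"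
  unfolding zigzag_def by blast

text \<open>The rows \<open>r (n - 1)\<close> and \<open>r n\<close> differ at \<open>c n\<close> in the wrong direction, so the lexical order
  yields a later column \<open>y\<close> where they differ last. All rows up to \<open>r (n - 1)\<close> agree at \<open>y\<close>.\<close>

lemma zigzag_new_column:
  assumes zz: "zigzag X Y R p q r c n" and n: "1 \<le> n" and lex: "rows_lexical X Y R p q"
  obtains y where "y \<in> Y" "q (c n) < q y" "\<And>i. i \<le> n \<Longrightarrow> R (r i) y \<longleftrightarrow> i = n"
    "\<And>t. t \<in> Y \<Longrightarrow> q y < q t \<Longrightarrow> R (r (n - 1)) t = R (r n) t"
proof -
  have XY: "\<And>i. i \<le> n \<Longrightarrow> r i \<in> X \<and> c i \<in> Y"
    and mono: "\<And>i j. i < j \<Longrightarrow> j \<le> n \<Longrightarrow> p (r i) < p (r j) \<and> q (c i) < q (c j)"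
    and R: "\<And>i j. i \<le> n \<Longrightarrow> j \<le> n \<Longrightarrow> R (r i) (c j) \<longleftrightarrow> i = Suc j \<or> j = Suc i \<or> (i = 0 \<and> j = 0)"
    and agree: "\<And>i y. i + 2 \<le> n \<Longrightarrow> y \<in> Y \<Longrightarrow> q (c (i + 2)) < q y \<Longrightarrow> R (r i) y = R (r (i + 1)) y"
    using zz unfolding zigzag_def by blast+
  have "p (r (n - 1)) < p (r n)" "R (r (n - 1)) (c n)" "\<not> R (r n) (c n)"
    using mono[of "n - 1" n] R[of "n - 1" n] R[of n n] n by auto
  then obtain y where y: "y \<in> Y" "q (c n) < q y" "\<not> R (r (n - 1)) y" "R (r n) y"
      "\<forall>t\<in>Y. q y < q t \<longrightarrow> R (r (n - 1)) t = R (r n) t"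
    using lex XY[of "n - 1"] XY[of n] unfolding rows_lexical_def by (metis diff_le_self order_refl)
  have zero: "\<not> R (r (n - 1 - j)) y" for j
  proof (induction j)
    case 0
    then show ?case using y by simp
  next
    case (Suc j)
    show ?case
    proof (cases "Suc j \<le> n - 1")
      case False
      then have "n - 1 - Suc j = n - 1 - j" by simp
      then show ?thesis using Suc.IH by simp
    next
      case True
      let ?i = "n - 1 - Suc j"
      have "?i + 2 \<le> n" "?i + 1 = n - 1 - j" using True n by auto
      moreover have "q (c (?i + 2)) \<le> q (c n)"
        using mono[of "?i + 2" n] \<open>?i + 2 \<le> n\<close> by (cases "?i + 2 = n") auto
      ultimately show ?thesis
        using agree[of ?i y] y Suc.IH by simp
    qed
  qed
  have "R (r i) y \<longleftrightarrow> i = n" if "i \<le> n" for i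
  proof (cases "i = n")
    case False
    then have "n - 1 - (n - 1 - i) = i" using that by simp
    then show ?thesis using zero[of "n - 1 - i"] False by simp
  qed (use y in simp)
  then show thesis using that y by blast
qed

text \<open>A doubly lexical matrix without cycle submatrices of size at least three contains no
  submatrix with the pattern \<open>1 1 / 1 0\<close>: starting from such a pattern, the lexical order forces
  an ever longer zigzag.\<close>

lemma doubly_lexical_no_gamma:
  fixes R :: "'a \<Rightarrow> 'b \<Rightarrow> bool"
  assumes X: "finite X" and Y: "finite Y"
    and lex: "rows_lexical X Y R p q" "rows_lexical Y X (\<lambda>y x. R x y) q p"
    and no_cycle: "\<And>N r c. 2 \<le> N \<Longrightarrow> inj_on r {..N} \<Longrightarrow> inj_on c {..N} \<Longrightarrow>
      r ` {..N} \<subseteq> X \<Longrightarrow> c ` {..N} \<subseteq> Y \<Longrightarrow>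
      (\<And>i j. i \<le> N \<Longrightarrow> j \<le> N \<Longrightarrow>
         R (r i) (c j) \<longleftrightarrow> i = Suc j \<or> j = Suc i \<or> (i = j \<and> (i = 0 \<or> i = N))) \<Longrightarrow> False"
    and ab: "a \<in> X" "b \<in> X" "p a < p b" and dc: "d \<in> Y" "c \<in> Y" "q d < q c"
    and gamma: "R a d" "R a c" "R b d" "\<not> R b c"
  shows False
proof -
  have ex: "\<exists>r c. zigzag X Y R p q r c (Suc n)" for n
  proof (induction n)
    case 0
    have "zigzag X Y R p q (\<lambda>i. if i = 0 then a else b) (\<lambda>i. if i = 0 then d else c) (Suc 0)"
      using ab dc gamma unfolding zigzag_def by (auto simp: le_Suc_eq)
    then show ?case by blast
  next
    case (Suc n)
    let ?n = "Suc n" and ?N = "Suc (Suc n)"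
    obtain r c where zz: "zigzag X Y R p q r c ?n" using Suc by blast
    obtain y where y: "y \<in> Y" "q (c ?n) < q y" "\<And>i. i \<le> ?n \<Longrightarrow> R (r i) y \<longleftrightarrow> i = ?n"
        "\<And>t. t \<in> Y \<Longrightarrow> q y < q t \<Longrightarrow> R (r n) t = R (r ?n) t"
      using zigzag_new_column[OF zz _ lex(1)] by auto
    obtain x where x: "x \<in> X" "p (r ?n) < p x" "\<And>i. i \<le> ?n \<Longrightarrow> R x (c i) \<longleftrightarrow> i = ?n"
        "\<And>t. t \<in> X \<Longrightarrow> p x < p t \<Longrightarrow> R t (c n) = R t (c ?n)"
      using zigzag_new_column[OF zigzag_sym[OF zz] _ lex(2)] by auto
    let ?r = "r(?N := x)" and ?c = "c(?N := y)"
    have XY: "\<And>i. i \<le> ?n \<Longrightarrow> r i \<in> X \<and> c i \<in> Y"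
      and mono: "\<And>i j. i < j \<Longrightarrow> j \<le> ?n \<Longrightarrow> p (r i) < p (r j) \<and> q (c i) < q (c j)"
      and R: "\<And>i j. i \<le> ?n \<Longrightarrow> j \<le> ?n \<Longrightarrow> R (r i) (c j) \<longleftrightarrow> i = Suc j \<or> j = Suc i \<or> (i = 0 \<and> j = 0)"
      and agree: "\<And>i t. i + 2 \<le> ?n \<Longrightarrow> t \<in> Y \<Longrightarrow> q (c (i + 2)) < q t \<Longrightarrow> R (r i) t = R (r (i + 1)) t"
        "\<And>i t. i + 2 \<le> ?n \<Longrightarrow> t \<in> X \<Longrightarrow> p (r (i + 2)) < p t \<Longrightarrow> R t (c i) = R t (c (i + 1))"
      using zz unfolding zigzag_def by blast+
    have XY': "?r i \<in> X \<and> ?c i \<in> Y" if "i \<le> ?N" for i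
      using XY[of i] that x y by (auto simp: le_Suc_eq)
    have mono': "p (?r i) < p (?r j) \<and> q (?c i) < q (?c j)" if "i < j" "j \<le> ?N" for i j
    proof (cases "j = ?N")
      case True
      have "p (r i) \<le> p (r ?n) \<and> q (c i) \<le> q (c ?n)"
        using mono[of i ?n] that by (cases "i = ?n") auto
      then show ?thesis using True that x(2) y(2) by auto
    next
      case False
      then show ?thesis using mono[of i j] that by simp
    qed
    have R': "R (?r i) (?c j) \<longleftrightarrow>
        i = Suc j \<or> j = Suc i \<or> (i = 0 \<and> j = 0) \<or> (i = ?N \<and> j = ?N \<and> R x y)"
      if "i \<le> ?N" "j \<le> ?N" for i j
      using R[of i j] y(3)[of i] x(3)[of j] that by (cases "i = ?N"; cases "j = ?N") auto
    have "\<not> R x y"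
    proof
      assume xy: "R x y"
      show False
      proof (rule no_cycle[of ?N ?r ?c])
        show "inj_on ?r {..?N}" "inj_on ?c {..?N}"
          by (rule linorder_inj_onI; use mono' in fastforce)+
        show "?r ` {..?N} \<subseteq> X" "?c ` {..?N} \<subseteq> Y" using XY' by blast+
        show "R (?r i) (?c j) \<longleftrightarrow> i = Suc j \<or> j = Suc i \<or> (i = j \<and> (i = 0 \<or> i = ?N))"
          if "i \<le> ?N" "j \<le> ?N" for i j
          using R'[OF that] xy by blast
      qed simp
    qed
    have "zigzag X Y R p q ?r ?c ?N"
      unfolding zigzag_def
    proof (intro conjI allI impI ballI)
      fix i t assume i: "i + 2 \<le> ?N" and t: "t \<in> Y" "q (?c (i + 2)) < q t"
      show "R (?r i) t = R (?r (i + 1)) t"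
        using agree(1)[of i t] y(4)[of t] i t by (cases "i + 2 = ?N") auto
    next
      fix i t assume i: "i + 2 \<le> ?N" and t: "t \<in> X" "p (?r (i + 2)) < p t"
      show "R t (?c i) = R t (?c (i + 1))"
        using agree(2)[of i t] x(4)[of t] i t by (cases "i + 2 = ?N") auto
    qed (use XY' mono' R' \<open>\<not> R x y\<close> in blast)+
    then show ?case by blast
  qed
  \<comment> \<open>The rows of a zigzag are distinct, so its length is bounded.\<close>
  obtain r c where zz: "zigzag X Y R p q r c (Suc (card X))" using ex by blast
  then have "inj_on r {..Suc (card X)}"
    unfolding zigzag_def by (intro linorder_inj_onI') (metis atMost_iff less_irrefl)
  moreover have "r ` {..Suc (card X)} \<subseteq> X" using zz unfolding zigzag_def by blast
  ultimately have "card {..Suc (card X)} \<le> card X" using X card_inj_on_le by blast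
  then show False by simp
qed


section \<open>Antiholes in graphs covered by two cliques\<close>

lemma is_holeI:
  assumes H: "simple_graph H" and k: "5 \<le> k" and h: "bij_betw h {..<k} (verts H)"
    and adj: "\<And>s t. s < t \<Longrightarrow> t < k \<Longrightarrow> adj H (h s) (h t) \<longleftrightarrow> t = Suc s \<or> (s = 0 \<and> Suc t = k)"
  shows "is_hole H"
proof -
  let ?C = "edges (cycle_graph k)"
  have sub: "e \<subseteq> {..<k}" if "e \<in> ?C" for e
    using that k by (auto simp: cycle_graph_def)
  have "edges H = (\<lambda>e. h ` e) ` ?C"
  proof (intro equalityI subsetI)
    fix e assume e: "e \<in> edges H"
    then have "e \<in> nsets (verts H) 2" using H by (auto simp: simple_graph_def)
    then obtain u v where uv: "e = {u, v}" "u \<in> verts H" "v \<in> verts H" "u \<noteq> v" by (rule nsets2_E)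
    then obtain s t where st: "s < k" "t < k" "u = h s" "v = h t"
      by (metis bij_betw_imp_surj_on[OF h] imageE lessThan_iff)
    have *: "{h s, h t} \<in> (\<lambda>e. h ` e) ` ?C" if "s < t" "t < k" "adj H (h s) (h t)" for s t
    proof -
      have "t = Suc s \<or> (s = 0 \<and> Suc t = k)" using adj[OF that(1,2)] that(3) by simp
      then consider "t = Suc s" | "s = 0" "Suc t = k" by blast
      then have "{s, t} \<in> ?C"
      proof cases
        case 1
        then have "{s, t} = {s, Suc s mod k}" using that(2) by (metis mod_less)
        moreover have "s < k" using that(1,2) by simp
        ultimately show ?thesis unfolding cycle_graph_def by auto
      next
        case 2
        then have "{s, t} = {t, Suc t mod k}" by auto
        then show ?thesis using that(2) unfolding cycle_graph_def by auto
      qed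
      then show ?thesis by (rule image_eqI[rotated]) simp
    qed
    have "adj H (h s) (h t)" "s \<noteq> t"
      using e uv st by (auto simp: adj_def)
    moreover from this have "adj H (h t) (h s)" using adj_sym[of H] by blast
    ultimately show "e \<in> (\<lambda>e. h ` e) ` ?C"
      using *[of s t] *[of t s] st uv(1) by (cases s t rule: linorder_cases) (auto simp: insert_commute)
  next
    fix e assume "e \<in> (\<lambda>e. h ` e) ` ?C"
    then obtain i where i: "i < k" "e = {h i, h (Suc i mod k)}"
      unfolding cycle_graph_def by auto
    show "e \<in> edges H"
    proof (cases "Suc i = k")
      case True
      then have "adj H (h 0) (h i)" using adj[of 0 i] k by auto
      then show ?thesis using i True by (simp add: adj_def insert_commute)
    next
      case False
      then have "adj H (h i) (h (Suc i))" "Suc i mod k = Suc i" using adj[of i "Suc i"] i by auto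
      then show ?thesis using i by (simp add: adj_def)
    qed
  qed
  moreover have "inv_into {..<k} h ` h ` e = e" if "e \<in> ?C" for e
    using bij_betw_imp_inj_on[OF h] sub[OF that] by (rule inv_into_image_cancel)
  ultimately have "?C = (\<lambda>e. inv_into {..<k} h ` e) ` edges H"
    by (simp add: image_image)
  moreover have "bij_betw (inv_into {..<k} h) (verts H) (verts (cycle_graph k))"
    using bij_betw_inv_into[OF h] by (simp add: cycle_graph_def)
  ultimately have "graph_isomorphic H (cycle_graph k)"
    unfolding graph_isomorphic_def by blast
  then show ?thesis unfolding is_hole_def using k by blast
qed

text \<open>A cycle submatrix of the nonadjacency matrix with \<open>N + 1\<close> rows is an antihole on \<open>2 N + 2\<close>
  vertices.\<close>

lemma cycle_matrix_antihole:
  assumes G: "simple_graph G" and XY: "X \<inter> Y = {}" "X \<subseteq> verts G" "Y \<subseteq> verts G"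
    and cliques: "clique X (edges G)" "clique Y (edges G)"
    and N: "2 \<le> N" and rc: "inj_on r {..N}" "inj_on c {..N}" "r ` {..N} \<subseteq> X" "c ` {..N} \<subseteq> Y"
    and pattern: "\<And>i j. i \<le> N \<Longrightarrow> j \<le> N \<Longrightarrow>
      \<not> adj G (r i) (c j) \<longleftrightarrow> i = Suc j \<or> j = Suc i \<or> (i = j \<and> (i = 0 \<or> i = N))"
  shows "is_antihole (induced_subgraph G (r ` {..N} \<union> c ` {..N}))"
proof -
  let ?W = "r ` {..N} \<union> c ` {..N}" and ?k = "2 * N + 2"
  let ?H = "graph_complement (induced_subgraph G ?W)"
  define m where "m t = min t (2 * N + 1 - t)" for t
  \<comment> \<open>The cycle runs \<open>r 0, c 1, r 2, \<dots>\<close> up to index \<open>N\<close> and back along the other half.\<close>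
  define h where "h t = (if even t then r (m t) else c (m t))" for t
  have m: "m t \<le> N" if "t < ?k" for t using that by (auto simp: m_def)
  have m_eq: "s = t" if "m s = m t" "even s = even t" "s < ?k" "t < ?k" for s t
    using that unfolding m_def min_def by (auto split: if_splits; presburger)
  have hX: "h t \<in> X" if "even t" "t < ?k" for t using rc(3) m that by (auto simp: h_def)
  have hY: "h t \<in> Y" if "odd t" "t < ?k" for t using rc(4) m that by (auto simp: h_def)
  have inj: "inj_on h {..<?k}"
  proof (rule inj_onI)
    fix s t assume st: "s \<in> {..<?k}" "t \<in> {..<?k}" "h s = h t"
    have par: "even s = even t" using st hX hY XY(1) by (metis disjoint_iff lessThan_iff)
    have "m s = m t"
      using st par rc(1,2) m[of s] m[of t] by (cases "even s") (auto simp: h_def inj_on_def)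
    then show "s = t" using m_eq par st by auto
  qed
  have surj: "h ` {..<?k} = ?W"
  proof
    show "h ` {..<?k} \<subseteq> ?W" using m by (auto simp: h_def)
    have "r i \<in> h ` {..<?k}" "c i \<in> h ` {..<?k}" if "i \<le> N" for i
    proof -
      let ?j = "2 * N + 1 - i"
      have "m i = i" "m ?j = i" "i < ?k" "?j < ?k" "even ?j \<longleftrightarrow> odd i"
        using that by (auto simp: m_def)
      then have "h i = (if even i then r i else c i)" "h ?j = (if even i then c i else r i)"
        by (auto simp: h_def)
      then show "r i \<in> h ` {..<?k}" "c i \<in> h ` {..<?k}"
        using \<open>i < ?k\<close> \<open>?j < ?k\<close> by (metis imageI lessThan_iff)+
    qed
    then show "?W \<subseteq> h ` {..<?k}" by blast
  qed
  have adjH: "adj ?H u v \<longleftrightarrow> u \<in> ?W \<and> v \<in> ?W \<and> u \<noteq> v \<and> \<not> adj G u v" for u v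
    unfolding adj_graph_complement adj_induced_subgraph by (auto simp: induced_subgraph_def)
  have "is_hole ?H"
  proof (rule is_holeI)
    show "simple_graph ?H"
      by (rule simple_graph_complement) (simp add: induced_subgraph_def)
    show "5 \<le> ?k" using N by simp
    show "bij_betw h {..<?k} (verts ?H)"
      using inj surj by (simp add: bij_betw_def graph_complement_def induced_subgraph_def)
  next
    fix s t assume st: "s < t" "t < ?k"
    have W: "h s \<in> ?W" "h t \<in> ?W" using surj st by (metis imageI lessThan_iff order_less_trans)+
    have ne: "h s \<noteq> h t" using inj st by (auto simp: inj_on_def)
    have ms: "m s \<le> N" "m t \<le> N" using m st by auto
    show "adj ?H (h s) (h t) \<longleftrightarrow> t = Suc s \<or> (s = 0 \<and> Suc t = ?k)"
    proof (cases "even s = even t")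
      case True
      have "adj G (h s) (h t)"
      proof (cases "even s")
        case True
        then have "h s \<in> X" "h t \<in> X" using hX st \<open>even s = even t\<close> by auto
        then show ?thesis using cliques(1) ne by (auto simp: clique_def adj_def)
      next
        case False
        then have "h s \<in> Y" "h t \<in> Y" using hY st \<open>even s = even t\<close> by auto
        then show ?thesis using cliques(2) ne by (auto simp: clique_def adj_def)
      qed
      then show ?thesis using True st unfolding adjH by auto
    next
      case False
      define i j where "i = (if even s then m s else m t)" and "j = (if even s then m t else m s)"
      have "adj G (h s) (h t) \<longleftrightarrow> adj G (r i) (c j)"
        using False adj_sym[of G "r (m t)" "c (m s)"]
        by (cases "even s") (simp_all add: h_def i_def j_def)
      then have "adj ?H (h s) (h t) \<longleftrightarrow> i = Suc j \<or> j = Suc i \<or> (i = j \<and> (i = 0 \<or> i = N))"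
        using pattern[of i j] ms W ne unfolding adjH by (auto simp: i_def j_def)
      also have "\<dots> \<longleftrightarrow> m s = Suc (m t) \<or> m t = Suc (m s) \<or> (m s = m t \<and> (m s = 0 \<or> m s = N))"
        by (auto simp: i_def j_def)
      also have "\<dots> \<longleftrightarrow> t = Suc s \<or> (s = 0 \<and> Suc t = ?k)"
      proof -
        have ms: "m s = (if s \<le> N then s else 2 * N + 1 - s)" "m t = (if t \<le> N then t else 2 * N + 1 - t)"
          by (auto simp: m_def)
        consider "t \<le> N" | "s \<le> N" "N < t" | "N < s" using st(1) by linarith
        then show ?thesis
        proof cases
          case 1
          then show ?thesis using st unfolding ms by auto
        next
          case 2
          define u where "u = 2 * N + 1 - t"
          have t: "t = 2 * N + 1 - u" "u \<le> N" using 2 st by (auto simp: u_def)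
          have "even s \<longleftrightarrow> even u" using False t by auto
          then have "s \<noteq> Suc u" "u \<noteq> Suc s" by auto
          then show ?thesis using 2 t unfolding ms by auto
        next
          case 3
          then show ?thesis using st unfolding ms by auto
        qed
      qed
      finally show ?thesis .
    qed
  qed
  then show ?thesis by (simp add: is_antihole_def)
qed

lemma cobipartite_obstruction_free:
  assumes G: "simple_graph G" and V: "verts G = X \<union> Y" "X \<inter> Y = {}"
    and cliques: "clique X (edges G)" "clique Y (edges G)" and free: "antihole_free G"
  shows "\<exists>p. inj_on p (verts G) \<and> obstruction_free G p"
proof -
  have fin: "finite X" "finite Y" using G V by (auto simp: simple_graph_def)
  obtain p q where pq: "inj_on p X" "inj_on q Y"
    and lex: "rows_lexical X Y (\<lambda>x y. \<not> adj G x y) p q" "rows_lexical Y X (\<lambda>y x. \<not> adj G x y) q p"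
    by (rule ex_doubly_lexical[OF fin])
  have no_gamma: False
    if "a \<in> X" "b \<in> X" "p a < p b" "d \<in> Y" "c \<in> Y" "q d < q c"
      "\<not> adj G a d" "\<not> adj G a c" "\<not> adj G b d" "adj G b c" for a b c d
  proof (rule doubly_lexical_no_gamma[OF fin lex _ that(1-9)])
    fix N :: nat and r c
    assume *: "2 \<le> N" "inj_on r {..N}" "inj_on c {..N}" "r ` {..N} \<subseteq> X" "c ` {..N} \<subseteq> Y"
      "\<And>i j. i \<le> N \<Longrightarrow> j \<le> N \<Longrightarrow>
        \<not> adj G (r i) (c j) \<longleftrightarrow> i = Suc j \<or> j = Suc i \<or> (i = j \<and> (i = 0 \<or> i = N))"
    have "is_antihole (induced_subgraph G (r ` {..N} \<union> c ` {..N}))"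
      by (rule cycle_matrix_antihole[OF G V(2) _ _ cliques *]) (use V in auto)
    moreover have "r ` {..N} \<union> c ` {..N} \<subseteq> verts G" using *(4,5) V by blast
    ultimately show False using free unfolding antihole_free_def by blast
  qed (use that in simp)
  \<comment> \<open>Only the order inside each clique matters; parity makes \<open>s\<close> injective across the two.\<close>
  define s where "s v = (if v \<in> X then 2 * p v else 2 * q v + 1)" for v
  have sX: "s u < s v \<longleftrightarrow> p u < p v" if "u \<in> X" "v \<in> X" for u v using that by (simp add: s_def)
  have sY: "s u < s v \<longleftrightarrow> q u < q v" if "u \<in> Y" "v \<in> Y" for u v
    using that V(2) by (auto simp: s_def)
  have "inj_on s (verts G)"
  proof (rule inj_onI)
    fix u v assume uv: "u \<in> verts G" "v \<in> verts G" "s u = s v"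
    have "u \<in> X \<longleftrightarrow> v \<in> X" using uv(3) unfolding s_def by (auto split: if_splits; presburger)
    then show "u = v" using uv pq V by (auto simp: s_def inj_on_def split: if_splits)
  qed
  moreover have "obstruction_free G s"
    unfolding obstruction_free_def
  proof (intro allI impI notI)
    fix a b c d
    assume *: "adj G a b \<and> adj G b c \<and> adj G c d \<and> \<not> adj G a c \<and> \<not> adj G a d \<and> \<not> adj G b d"
      and less: "s a < s b \<and> s d < s c"
    have verts: "a \<in> X \<union> Y" "b \<in> X \<union> Y" "c \<in> X \<union> Y" "d \<in> X \<union> Y"
      using * simple_graph_adjD[OF G] V(1) by blast+
    have ne: "a \<noteq> c" "a \<noteq> d" "b \<noteq> d" using * adj_sym[of G] by metis+
    have sides: "\<not> (u \<in> X \<and> v \<in> X) \<and> \<not> (u \<in> Y \<and> v \<in> Y)" if "u \<noteq> v" "\<not> adj G u v" for u v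
      using cliques that by (auto simp: clique_def adj_def)
    note s1 = sides[OF ne(1)] sides[OF ne(2)] sides[OF ne(3)]
    consider "a \<in> X" "b \<in> X" "c \<in> Y" "d \<in> Y" | "a \<in> Y" "b \<in> Y" "c \<in> X" "d \<in> X"
      using s1 * verts by blast
    then show False
    proof cases
      case 1
      then show False using no_gamma[of a b d c] * less sX[of a b] sY[of d c] by blast
    next
      case 2
      then show False
        using no_gamma[of d c a b] * less sX[of d c] sY[of a b] adj_sym[of G] by metis
    qed
  qed
  ultimately show ?thesis by blast
qed


section \<open>Generalized split graphs\<close>

lemma unipolar_induced_subgraph:
  assumes "unipolar G" "W \<subseteq> verts G"
  shows "unipolar (induced_subgraph G W)"
proof -
  obtain k :: nat and C where C: "(\<Union>i\<le>k. C i) = verts G" "disjoint_family_on C {..k}"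
    "\<forall>i\<le>k. clique (C i) (edges G)"
    "\<forall>i j. 1 \<le> i \<and> i < j \<and> j \<le> k \<longrightarrow> (\<forall>u\<in>C i. \<forall>v\<in>C j. \<not> adj G u v)"
    using assms(1) unfolding unipolar_def by blast
  have "(\<Union>i\<le>k. C i \<inter> W) = verts (induced_subgraph G W)"
    using C(1) assms(2) by (auto simp: induced_subgraph_def)
  moreover have "disjoint_family_on (\<lambda>i. C i \<inter> W) {..k}"
    using C(2) by (auto simp: disjoint_family_on_def)
  moreover have "\<forall>i\<le>k. clique (C i \<inter> W) (edges (induced_subgraph G W))"
    using C(3) by (auto simp: clique_def induced_subgraph_def)
  moreover have "\<forall>i j. 1 \<le> i \<and> i < j \<and> j \<le> k \<longrightarrow>
      (\<forall>u\<in>C i \<inter> W. \<forall>v\<in>C j \<inter> W. \<not> adj (induced_subgraph G W) u v)"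
    using C(4) by (auto simp: adj_induced_subgraph)
  ultimately show ?thesis
    unfolding unipolar_def by (intro exI[of _ k] exI[of _ "\<lambda>i. C i \<inter> W"]) blast
qed

lemma antihole_free_induced_subgraph:
  assumes "antihole_free G" "W \<subseteq> verts G"
  shows "antihole_free (induced_subgraph G W)"
  unfolding antihole_free_def
proof (intro allI impI)
  fix W' assume "W' \<subseteq> verts (induced_subgraph G W)"
  then have W': "W' \<subseteq> W" by (simp add: induced_subgraph_def)
  then show "\<not> is_antihole (induced_subgraph (induced_subgraph G W) W')"
    using assms unfolding antihole_free_def induced_subgraph_twice[OF W'] by blast
qed

text \<open>An induction principle for antihole-free unipolar graphs: properties of graphs with an
  obstruction-free ordering that are preserved by gluing along a clique.\<close>

lemma unipolar_gluing_induct: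
  fixes G :: "'a graph"
  assumes G: "simple_graph G" and uni: "unipolar G" and free: "antihole_free G"
    and base: "\<And>(H :: 'a graph) p. simple_graph H \<Longrightarrow> inj_on p (verts H) \<Longrightarrow> obstruction_free H p \<Longrightarrow> P H"
    and glue: "\<And>(H :: 'a graph) H1 H2. P H1 \<Longrightarrow> P H2 \<Longrightarrow> glued_along_clique H H1 H2 \<Longrightarrow> P H"
  shows "P G"
proof -
  obtain k :: nat and C where raw: "(\<Union>i\<le>k. C i) = verts G \<and> disjoint_family_on C {..k} \<and>
     (\<forall>i\<le>k. clique (C i) (edges G)) \<and>
     (\<forall>i j. 1 \<le> i \<and> i < j \<and> j \<le> k \<longrightarrow> (\<forall>u\<in>C i. \<forall>v\<in>C j. \<not> adj G u v))"
    using uni unfolding unipolar_def by (elim exE)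
  have C: "(\<Union>i\<le>k. C i) = verts G" "disjoint_family_on C {..k}"
    "\<And>i. i \<le> k \<Longrightarrow> clique (C i) (edges G)"
    "\<And>i j u v. 1 \<le> i \<Longrightarrow> i < j \<Longrightarrow> j \<le> k \<Longrightarrow> u \<in> C i \<Longrightarrow> v \<in> C j \<Longrightarrow> \<not> adj G u v"
    using raw by simp_all
  have sep: "i = j" if "1 \<le> i" "1 \<le> j" "i \<le> k" "j \<le> k" "u \<in> C i" "v \<in> C j" "adj G u v" for i j u v
    using C(4)[of i j u v] C(4)[of j i v u] that adj_sym[of G u v] by (metis nat_neq_iff)
  have disj: "C i \<inter> C j = {}" if "i \<noteq> j" "i \<le> k" "j \<le> k" for i j
    using C(2) that by (auto simp: disjoint_family_on_def)
  have sub: "C i \<subseteq> verts G" if "i \<le> k" for i using C(1) that by blast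
  show ?thesis
  proof (cases "C 0 = {}")
    case True
    \<comment> \<open>A disjoint union of cliques has no induced path on four vertices at all.\<close>
    have trans: "adj G a c \<or> a = c" if ab: "adj G a b" and bc: "adj G b c" for a b c
    proof -
      have "a \<in> verts G" "b \<in> verts G" "c \<in> verts G" using simple_graph_adjD[OF G] ab bc by blast+
      then obtain i j l where ijl: "i \<le> k" "a \<in> C i" "j \<le> k" "b \<in> C j" "l \<le> k" "c \<in> C l"
        using C(1) by blast
      then have "1 \<le> i" "1 \<le> j" "1 \<le> l" using True by (metis One_nat_def Suc_leI empty_iff gr0I)+
      then have "i = j" "j = l" using sep[of i j a b] sep[of j l b c] ijl ab bc by auto
      then show ?thesis using C(3)[of i] ijl by (auto simp: clique_def adj_def)
    qed
    have "finite (verts G)" using G by (simp add: simple_graph_def)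
    from finite_imp_inj_to_nat_seg[OF this] obtain p :: "'a \<Rightarrow> nat" where "inj_on p (verts G)"
      by blast
    moreover have "obstruction_free G p"
      unfolding obstruction_free_def using trans by metis
    ultimately show ?thesis by (rule base[OF G])
  next
    case False
    have pair: "P (induced_subgraph G (C 0 \<union> D))"
      if D: "D \<subseteq> verts G" "C 0 \<inter> D = {}" "clique D (edges G)" for D
    proof -
      let ?H = "induced_subgraph G (C 0 \<union> D)"
      have W: "C 0 \<union> D \<subseteq> verts G" using D sub by blast
      have H: "simple_graph ?H" "antihole_free ?H" "verts ?H = C 0 \<union> D"
        using simple_graph_induced_subgraph[OF G W] antihole_free_induced_subgraph[OF free W]
        by (auto simp: induced_subgraph_def)
      have "clique (C 0) (edges ?H)" "clique D (edges ?H)"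
        using C(3)[of 0] D by (auto simp: clique_def induced_subgraph_def)
      then show ?thesis
        using cobipartite_obstruction_free[OF H(1) H(3) D(2) _ _ H(2)] base[OF H(1)] by blast
    qed
    have "P (induced_subgraph G (\<Union>i\<le>j. C i))" if "j \<le> k" for j
      using that
    proof (induction j)
      case 0
      then show ?case using pair[of "{}"] by (simp add: clique_def)
    next
      case (Suc j)
      let ?U = "\<Union>i\<le>j. C i" and ?D = "C (Suc j)"
      have P1: "P (induced_subgraph G ?U)" using Suc by simp
      have P2: "P (induced_subgraph G (C 0 \<union> ?D))"
        using Suc.prems by (intro pair sub disj C(3)) auto
      have U: "(\<Union>i\<le>Suc j. C i) = ?U \<union> ?D" by (auto simp: atMost_Suc)
      have U0: "C 0 \<subseteq> ?U" by blast
      have int: "?U \<inter> (C 0 \<union> ?D) = C 0"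
      proof -
        have "C i \<inter> ?D = {}" if "i \<le> j" for i using that Suc.prems by (intro disj) auto
        then show ?thesis using U0 by blast
      qed
      have split: "e \<subseteq> ?U \<or> e \<subseteq> C 0 \<union> ?D" if e: "e \<in> edges G" "e \<subseteq> ?U \<union> ?D" for e
      proof (rule ccontr)
        assume no: "\<not> ?thesis"
        have "e \<in> nsets (verts G) 2" using G e(1) by (auto simp: simple_graph_def)
        then obtain u v where uv: "e = {u, v}" by (rule nsets2_E)
        have *: False if uv: "u \<in> ?U" "u \<notin> C 0" "v \<in> ?D" "adj G u v" for u v
        proof -
          obtain i where i: "i \<le> j" "u \<in> C i" using uv(1) by blast
          then have "1 \<le> i" using uv(2) by (metis One_nat_def Suc_leI gr0I)
          then have "i = Suc j" using sep[of i "Suc j" u v] i uv Suc.prems by simp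
          then show False using i by simp
        qed
        have "adj G u v" "adj G v u" using e(1) uv by (simp_all add: adj_def insert_commute)
        then show False using *[of u v] *[of v u] no e(2) uv by blast
      qed
      have "glued_along_clique (induced_subgraph G (?U \<union> ?D)) (induced_subgraph G ?U)
          (induced_subgraph G (C 0 \<union> ?D))"
        unfolding glued_along_clique_def
      proof (intro conjI)
        show "verts (graph_inter (induced_subgraph G ?U) (induced_subgraph G (C 0 \<union> ?D))) \<noteq> {}"
          using False int by (simp add: graph_inter_def induced_subgraph_def)
        show "complete_graph (graph_inter (induced_subgraph G ?U) (induced_subgraph G (C 0 \<union> ?D)))"
          unfolding complete_graph_def graph_inter_def induced_subgraph_def graph.simps int
          using C(3)[of 0] U0 by (fastforce simp: clique_def)
        show "induced_subgraph G (?U \<union> ?D) =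
            graph_union (induced_subgraph G ?U) (induced_subgraph G (C 0 \<union> ?D))"
          unfolding graph_union_def induced_subgraph_def graph.simps
        proof (intro arg_cong2[of _ _ _ _ "\<lambda>V E. \<lparr>verts = V, edges = E\<rparr>"])
          show "?U \<union> ?D = ?U \<union> (C 0 \<union> ?D)" using U0 by blast
          show "{e \<in> edges G. e \<subseteq> ?U \<union> ?D} = {e \<in> edges G. e \<subseteq> ?U} \<union> {e \<in> edges G. e \<subseteq> C 0 \<union> ?D}"
            using split U0 by blast
        qed
      qed
      then show ?case unfolding U by (rule glue[OF P1 P2])
    qed
    from this[of k] show ?thesis using C(1) induced_subgraph_verts[OF G] by simp
  qed
qed

text \<open>In the graph itself the \<open>C i\<close> are stable, and those other than \<open>C 0\<close> are completely joined to each
  other. If \<open>C 0\<close> comes last, the ends \<open>a\<close> and \<open>d\<close> of an obstruction lie in a common \<open>C i\<close> with \<open>i \<ge> 1\<close>.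
  Then \<open>b\<close> and \<open>c\<close>, each adjacent to only one of them, both lie in the stable set \<open>C 0\<close>.\<close>

lemma counipolar_obstruction_free:
  assumes G: "simple_graph G" and uni: "unipolar (graph_complement G)"
  shows "\<exists>p. inj_on p (verts G) \<and> obstruction_free G p"
proof -
  obtain k :: nat and C where raw: "(\<Union>i\<le>k. C i) = verts (graph_complement G) \<and> disjoint_family_on C {..k} \<and>
     (\<forall>i\<le>k. clique (C i) (edges (graph_complement G))) \<and>
     (\<forall>i j. 1 \<le> i \<and> i < j \<and> j \<le> k \<longrightarrow> (\<forall>u\<in>C i. \<forall>v\<in>C j. \<not> adj (graph_complement G) u v))"
    using uni unfolding unipolar_def by (elim exE)
  have C: "(\<Union>i\<le>k. C i) = verts G"
    "\<And>i. i \<le> k \<Longrightarrow> clique (C i) (edges (graph_complement G))"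
    "\<And>i j u v. 1 \<le> i \<Longrightarrow> i < j \<Longrightarrow> j \<le> k \<Longrightarrow> u \<in> C i \<Longrightarrow> v \<in> C j \<Longrightarrow> \<not> adj (graph_complement G) u v"
    and dis: "disjoint_family_on C {..k}"
    using raw by (simp_all add: graph_complement_def)
  have stable: "\<not> adj G u v" if "i \<le> k" "u \<in> C i" "v \<in> C i" for i u v
    using C(2)[OF that(1)] that simple_graph_adjD(3)[OF G, of u v]
    by (auto simp: clique_def graph_complement_def adj_def)
  have join: "adj G u v" if "1 \<le> i" "1 \<le> j" "i \<le> k" "j \<le> k" "i \<noteq> j" "u \<in> C i" "v \<in> C j" for i j u v
  proof -
    have "u \<noteq> v" using dis that by (auto simp: disjoint_family_on_def)
    moreover have "u \<in> verts G" "v \<in> verts G" using C(1) that by blast+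
    moreover have "\<not> adj (graph_complement G) u v"
      using C(3)[of i j u v] C(3)[of j i v u] that adj_sym[of "graph_complement G" u v] by (metis nat_neq_iff)
    ultimately show ?thesis by (simp add: adj_graph_complement)
  qed
  have part: "\<exists>i. 1 \<le> i \<and> i \<le> k \<and> v \<in> C i" if v: "v \<in> verts G" "v \<notin> C 0" for v
  proof -
    obtain i where i: "i \<le> k" "v \<in> C i" using C(1) v(1) by blast
    then have "1 \<le> i" using v(2) by (cases i) auto
    then show ?thesis using i by blast
  qed
  have "finite (verts G)" using G by (simp add: simple_graph_def)
  from finite_imp_inj_to_nat_seg[OF this]
  obtain e :: "'a \<Rightarrow> nat" and n where e: "inj_on e (verts G)" "e ` verts G = {i. i < n}"
    by blast
  \<comment> \<open>The stable set \<open>C 0\<close> comes last.\<close>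
  define p where "p v = (if v \<in> C 0 then n + e v else e v)" for v
  have en: "e v < n" if "v \<in> verts G" for v using e(2) that by auto
  have "inj_on p (verts G)"
  proof (rule inj_onI)
    fix u v assume uv: "u \<in> verts G" "v \<in> verts G" "p u = p v"
    then have "e u = e v"
      using en[of u] en[of v] by (auto simp: p_def split: if_splits)
    then show "u = v" using e(1) uv by (auto dest: inj_onD)
  qed
  moreover have "obstruction_free G p"
    unfolding obstruction_free_def
  proof (intro allI impI notI)
    fix a b c d
    assume *: "adj G a b \<and> adj G b c \<and> adj G c d \<and> \<not> adj G a c \<and> \<not> adj G a d \<and> \<not> adj G b d"
      and less: "p a < p b \<and> p d < p c"
    have verts: "a \<in> verts G" "b \<in> verts G" "c \<in> verts G" "d \<in> verts G"
      using * simple_graph_adjD[OF G] by blast+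
    have late: "u \<notin> C 0" if "adj G u v" "p u < p v" for u v
    proof
      assume u: "u \<in> C 0"
      then have "v \<notin> C 0" using stable[of 0 u v] that(1) by auto
      then have "p v < n" using en simple_graph_adjD(2)[OF G that(1)] by (simp add: p_def)
      then show False using u that(2) by (simp add: p_def)
    qed
    have "a \<notin> C 0" using late[of a b] * less by blast
    moreover have "d \<notin> C 0" using late[of d c] * less adj_sym[of G c d] by blast
    ultimately obtain i j where ij: "1 \<le> i" "i \<le> k" "a \<in> C i" "1 \<le> j" "j \<le> k" "d \<in> C j"
      using part[OF verts(1)] part[OF verts(4)] by blast
    have "i = j" using join[of i j a d] ij * by blast
    have mid: "v \<in> C 0"
      if "v \<in> verts G" "adj G u v" "\<not> adj G u' v" "u \<in> C i" "u' \<in> C i" for u u' v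
    proof (rule ccontr)
      assume "v \<notin> C 0"
      from part[OF that(1) this] obtain l where l: "1 \<le> l" "l \<le> k" "v \<in> C l" by blast
      then have "l = i" using join[of i l u' v] that ij by blast
      then show False using stable[of i u v] that l by blast
    qed
    have "b \<in> C 0" using mid[of b a d] verts * ij \<open>i = j\<close> adj_sym[of G b d] by blast
    moreover have "c \<in> C 0" using mid[of c d a] verts * ij \<open>i = j\<close> adj_sym[of G c d] by blast
    ultimately show False using stable[of 0 b c] * by blast
  qed
  ultimately show ?thesis by blast
qed


section \<open>Sorting weights\<close>

text \<open>How often each vertex occurs in a multiset of stable sets, which is the exponent vector in the
  variables \<open>t\<^sub>j\<close> of the image of the monomial.\<close>

definition vertex_count :: "'a set multiset \<Rightarrow> 'a multiset" where
  "vertex_count M = (\<Sum>S\<in>#M. mset_set S)"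

lemma vertex_count_simps [simp]:
  "vertex_count {#} = {#}"
  "vertex_count (add_mset S M) = mset_set S + vertex_count M"
  "vertex_count (M + N) = vertex_count M + vertex_count N"
  by (simp_all add: vertex_count_def)

text \<open>The case \<open>A = B\<close> is included when \<open>A\<close> occurs twice, but then \<open>C = D = A\<close> is forced.\<close>

definition pairwise_minimal :: "'a graph \<Rightarrow> ('a set \<Rightarrow> int) \<Rightarrow> 'a set multiset \<Rightarrow> bool" where
  "pairwise_minimal G w M \<longleftrightarrow> (\<forall>A B. {#A, B#} \<subseteq># M \<longrightarrow>
     (\<forall>C\<in>stable_sets G. \<forall>D\<in>stable_sets G.
        vertex_count {#A, B#} = vertex_count {#C, D#} \<longrightarrow> w A + w B \<le> w C + w D))"

text \<open>Pairwise minimality, a condition on pairs of variables only, singles out at most one monomial in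
  each fiber of the toric map.\<close>

definition sorting_weight :: "'a graph \<Rightarrow> ('a set \<Rightarrow> int) \<Rightarrow> bool" where
  "sorting_weight G w \<longleftrightarrow> (\<forall>M N. set_mset M \<subseteq> stable_sets G \<longrightarrow> set_mset N \<subseteq> stable_sets G \<longrightarrow>
     size M = size N \<longrightarrow> vertex_count M = vertex_count N \<longrightarrow>
     pairwise_minimal G w M \<longrightarrow> pairwise_minimal G w N \<longrightarrow> M = N)"

lemma pairwise_minimalD:
  assumes "pairwise_minimal G w M" "{#A, B#} \<subseteq># M" "C \<in> stable_sets G" "D \<in> stable_sets G"
    "vertex_count {#A, B#} = vertex_count {#C, D#}"
  shows "w A + w B \<le> w C + w D"
  using assms unfolding pairwise_minimal_def by blast

lemma pairwise_minimal_mono: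
  "pairwise_minimal G w M \<Longrightarrow> N \<subseteq># M \<Longrightarrow> pairwise_minimal G w N"
  unfolding pairwise_minimal_def using subset_mset.order_trans by blast

lemma set_mset_vertex_count:
  assumes "\<And>S. S \<in># M \<Longrightarrow> finite S"
  shows "set_mset (vertex_count M) = \<Union> (set_mset M)"
  using assms by (induction M) auto

lemma mset_set_pair:
  assumes "finite A" "finite B" "finite C" "finite D" "A \<union> B = C \<union> D" "A \<inter> B = C \<inter> D"
  shows "mset_set A + mset_set B = mset_set C + mset_set D"
proof (rule multiset_eqI)
  fix x
  have "(x \<in> A \<or> x \<in> B) = (x \<in> C \<or> x \<in> D)" "(x \<in> A \<and> x \<in> B) = (x \<in> C \<and> x \<in> D)"
    using assms by auto
  then show "count (mset_set A + mset_set B) x = count (mset_set C + mset_set D) x"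
    using assms(1-4) by (auto simp: count_mset_set')
qed

text \<open>Of two stable sets, remove a greedily chosen stable subset \<open>T\<close> of the union. What is left,
  together with the common vertices, is again stable: an edge left over would form an obstruction with
  the earlier neighbors of its ends in \<open>T\<close>.\<close>

lemma stable_greedy_rest:
  assumes G: "simple_graph G" and free: "obstruction_free G p"
    and S: "S \<in> stable_sets G" "S' \<in> stable_sets G" and T: "T \<in> stable_sets G" "T \<subseteq> S \<union> S'"
    and greedy: "\<And>v. v \<in> S \<union> S' - T \<Longrightarrow> \<exists>u\<in>T. adj G u v \<and> p u < p v"
  shows "S \<inter> S' \<subseteq> T" "(S \<union> S' - T) \<union> (S \<inter> S') \<in> stable_sets G"
proof -
  note st = S T(1)
  have nadj: "\<not> adj G u v" if "u \<in> A" "v \<in> A" "A \<in> {S, S', T}" for u v A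
    using that st stable_sets_iff[OF G] by auto
  show sub: "S \<inter> S' \<subseteq> T"
  proof
    fix v assume v: "v \<in> S \<inter> S'"
    show "v \<in> T"
    proof (rule ccontr)
      assume "v \<notin> T"
      then obtain u where "u \<in> T" "adj G u v" using greedy[of v] v by blast
      then show False using nadj[of u S v] nadj[of u S' v] T(2) v by blast
    qed
  qed
  have *: "\<not> adj G v w" if vw: "v \<in> S - T" "w \<in> S' - T" for v w
  proof
    assume adj: "adj G v w"
    obtain a where a: "a \<in> T" "adj G a v" "p a < p v" using greedy[of v] vw by auto
    obtain d where d: "d \<in> T" "adj G d w" "p d < p w" using greedy[of w] vw by auto
    have "a \<in> S'" "d \<in> S" using a d vw T(2) nadj by blast+
    then have "\<not> adj G a w" "\<not> adj G a d" "\<not> adj G v d"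
      using a d vw nadj by blast+
    then show False
      using free adj a d unfolding obstruction_free_def by (metis adj_sym)
  qed
  show "(S \<union> S' - T) \<union> (S \<inter> S') \<in> stable_sets G"
    unfolding stable_sets_iff[OF G]
  proof (intro conjI ballI)
    show "(S \<union> S' - T) \<union> (S \<inter> S') \<subseteq> verts G"
      using st stable_sets_iff[OF G] by blast
    fix u v
    assume "u \<in> (S \<union> S' - T) \<union> (S \<inter> S')" "v \<in> (S \<union> S' - T) \<union> (S \<inter> S')"
    then show "\<not> adj G u v"
      using nadj[of u S v] nadj[of u S' v] *[of u v] *[of v u] adj_sym[of G u v] by blast
  qed
qed

lemma sum_squares_le_imp_eq:
  fixes a b t t' :: int
  assumes "a \<ge> b" "t \<ge> a" "t + t' = a + b" "t\<^sup>2 + t'\<^sup>2 \<le> a\<^sup>2 + b\<^sup>2"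
  shows "t = a"
proof -
  define d where "d = t - a"
  have t: "t = a + d" "t' = b - d" using assms(3) by (auto simp: d_def)
  have "2 * (d * (a - b)) + 2 * d\<^sup>2 \<le> 0"
    using assms(4) unfolding t by (simp add: power2_eq_square algebra_simps)
  moreover have "d * (a - b) \<ge> 0" using assms by (simp add: d_def)
  ultimately have "d\<^sup>2 \<le> 0" by linarith
  then show ?thesis by (simp add: d_def)
qed

text \<open>The greedy stable subset of \<open>U\<close> is unique.\<close>

lemma greedy_sets_eq:
  assumes nadj: "\<And>u v. u \<in> T \<Longrightarrow> v \<in> T \<Longrightarrow> \<not> adj G u v" "\<And>u v. u \<in> T' \<Longrightarrow> v \<in> T' \<Longrightarrow> \<not> adj G u v"
    and sub: "T \<subseteq> U" "T' \<subseteq> U"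
    and greedy: "\<And>v. v \<in> U - T \<Longrightarrow> \<exists>u\<in>T. adj G u v \<and> p u < p v"
      "\<And>v. v \<in> U - T' \<Longrightarrow> \<exists>u\<in>T'. adj G u v \<and> (p u :: nat) < p v"
  shows "T = T'"
proof -
  have "v \<in> T \<longleftrightarrow> v \<in> T'" for v
  proof (induction "p v" arbitrary: v rule: less_induct)
    case less
    then show ?case using nadj sub greedy by (metis Diff_iff subsetD)
  qed
  then show ?thesis by blast
qed

text \<open>Reading a stable set as a binary number \<open>b S\<close>, with early vertices as leading digits, the weight
  is \<open>- (b S)\<^sup>2\<close>. Within a fiber of pairs the sum of the two values is constant, so a pair of minimal
  weight is one that spreads the two values as far apart as possible.\<close>

lemma sorting_weight_obstruction_free:
  assumes G: "simple_graph G" and inj: "inj_on p (verts G)" and free: "obstruction_free G p"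
  shows "\<exists>w. sorting_weight G w"
proof -
  have finV: "finite (verts G)" using G by (simp add: simple_graph_def)
  obtain N where N: "\<And>v. v \<in> verts G \<Longrightarrow> p v \<le> N"
    using finV by (meson finite_imageI finite_nat_set_iff_bounded_le imageI)
  \<comment> \<open>Digit positions run against the order, so that early vertices are leading digits.\<close>
  define q where "q v = N - p v" for v
  have q_less: "q u < q v \<longleftrightarrow> p v < p u" if "u \<in> verts G" "v \<in> verts G" for u v
    using N[OF that(1)] N[OF that(2)] by (auto simp: q_def)
  have q_inj: "inj_on q (verts G)"
    using inj N by (auto simp: inj_on_def q_def) (metis diff_diff_cancel)
  define b where "b = binary_value q"
  define w where "w S = - (int (b S))\<^sup>2" for S
  note fin = finite_stable_set[OF G]
  note st_iff = stable_sets_iff[OF G]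
  have sub: "S \<subseteq> verts G" if "S \<in> stable_sets G" for S using that st_iff by blast
  have inj_sub: "inj_on q A" if "A \<subseteq> verts G" for A
    using q_inj that by (rule inj_on_subset)
  \<comment> \<open>The stable set of largest value inside \<open>U\<close> is the one found greedily.\<close>
  have greedy_max: "\<exists>u\<in>T. adj G u v \<and> p u < p v"
    if T: "T \<in> stable_sets G" "T \<subseteq> U" and U: "U \<subseteq> verts G"
      and max: "\<And>T'. T' \<in> stable_sets G \<Longrightarrow> T' \<subseteq> U \<Longrightarrow> b T' \<le> b T" and v: "v \<in> U - T" for T U v
  proof (rule ccontr)
    assume *: "\<not> ?thesis"
    \<comment> \<open>Adding \<open>v\<close> at the expense of all later vertices increases the binary value.\<close>
    let ?C = "insert v {u \<in> T. p u < p v}"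
    have "\<not> adj G u v \<and> \<not> adj G v u" if "u \<in> T" "p u < p v" for u
      using * that adj_sym[of G u v] by blast
    then have "?C \<in> stable_sets G"
      using T U v simple_graph_adjD(3)[OF G, of v v] unfolding st_iff by auto
    moreover have "?C \<subseteq> U" using T v by auto
    moreover have "b T < b ?C"
      unfolding b_def
    proof (rule binary_value_less)
      show "finite T" "finite ?C" using T fin by auto
      show "inj_on q (T \<union> ?C)" using T U v by (intro inj_sub) auto
      show "v \<in> ?C" "v \<notin> T" using v by auto
      show "z \<in> T \<longleftrightarrow> z \<in> ?C" if "z \<in> T \<union> ?C" "q v < q z" for z
        using that T U v q_less[of v z] by auto
    qed
    ultimately show False using max[of ?C] by simp
  qed
  \<comment> \<open>In a minimal pair, the set of larger value is greedy inside the union.\<close>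
  have pair: "v \<in> S \<or> (\<exists>u\<in>S. adj G u v \<and> p u < p v)"
    if S: "S \<in> stable_sets G" "S' \<in> stable_sets G" and le: "b S' \<le> b S" and v: "v \<in> S'"
      and min: "\<And>C D. C \<in> stable_sets G \<Longrightarrow> D \<in> stable_sets G \<Longrightarrow>
        vertex_count {#S, S'#} = vertex_count {#C, D#} \<Longrightarrow> w S + w S' \<le> w C + w D" for S S' v
  proof -
    let ?U = "S \<union> S'" and ?F = "{T \<in> stable_sets G. T \<subseteq> S \<union> S'}"
    have U: "?U \<subseteq> verts G" using S sub by blast
    have "finite (b ` ?F)" "b ` ?F \<noteq> {}" using finite_stable_sets[OF G] S by auto
    then obtain T where T: "T \<in> ?F" "b T = Max (b ` ?F)"
      using Max_in by (metis (no_types, lifting) imageE)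
    have max: "b T' \<le> b T" if "T' \<in> stable_sets G" "T' \<subseteq> ?U" for T'
      using Max_ge[OF \<open>finite (b ` ?F)\<close>, of "b T'"] that T by auto
    have gr': "\<exists>u\<in>T. adj G u v \<and> p u < p v" if "v \<in> ?U - T" for v
      using greedy_max[of T ?U v] T U max that by blast
    let ?T' = "(?U - T) \<union> (S \<inter> S')"
    have T': "?T' \<in> stable_sets G" and int: "S \<inter> S' \<subseteq> T"
      using stable_greedy_rest[OF G free S _ _ gr'] T by auto
    have fins: "finite S" "finite S'" "finite T" "finite ?T'" using S T T' fin by auto
    have eq: "mset_set S + mset_set S' = mset_set T + mset_set ?T'"
      by (rule mset_set_pair) (use fins int T in auto)
    have "w S + w S' \<le> w T + w ?T'"
      using T T' by (intro min) (auto simp: eq)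
    then have "(int (b T))\<^sup>2 + (int (b ?T'))\<^sup>2 \<le> (int (b S))\<^sup>2 + (int (b S'))\<^sup>2"
      by (simp add: w_def)
    moreover have "b S + b S' = b T + b ?T'"
    proof -
      have b: "b A = (\<Sum>v\<in>#mset_set A. 2 ^ q v)" if "finite A" for A
        using that by (simp add: b_def binary_value_def sum_unfold_sum_mset)
      have "b S + b S' = (\<Sum>v\<in>#mset_set S + mset_set S'. 2 ^ q v)" using fins by (simp add: b)
      also have "\<dots> = b T + b ?T'" unfolding eq using fins by (simp add: b)
      finally show ?thesis .
    qed
    then have "int (b T) + int (b ?T') = int (b S) + int (b S')" by linarith
    moreover have "b S \<le> b T" using max S by auto
    ultimately have "int (b T) = int (b S)"
      using le by (intro sum_squares_le_imp_eq[of "int (b S')" "int (b S)" "int (b T)" "int (b ?T')"]) auto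
    then have "T = S"
      unfolding b_def using fins T S sub by (intro binary_value_inj[of T S q] inj_sub) auto
    then show ?thesis using gr' v by blast
  qed
  have "M = N" if "set_mset M \<subseteq> stable_sets G" "set_mset N \<subseteq> stable_sets G" "size M = size N"
      "vertex_count M = vertex_count N" "pairwise_minimal G w M" "pairwise_minimal G w N" for M N
    using that
  proof (induction "size M" arbitrary: M N)
    case 0
    then show ?case by simp
  next
    case (Suc n)
    \<comment> \<open>The element of largest value is determined by the support.\<close>
    have top: "\<exists>T. T \<in># P \<and> T \<subseteq> \<Union> (set_mset P) \<and> T \<in> stable_sets G \<and>
        (\<forall>v \<in> \<Union> (set_mset P) - T. \<exists>u\<in>T. adj G u v \<and> p u < p v)"
      if P: "set_mset P \<subseteq> stable_sets G" "pairwise_minimal G w P" "P \<noteq> {#}" for P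
    proof -
      have "b ` set_mset P \<noteq> {}" "finite (b ` set_mset P)" using P by auto
      then obtain T where T: "T \<in># P" "b T = Max (b ` set_mset P)"
        using Max_in by (metis (no_types, lifting) imageE)
      have "\<exists>u\<in>T. adj G u v \<and> p u < p v" if v: "v \<in> S" "S \<in># P" "v \<notin> T" for v S
      proof -
        have "T \<noteq> S" using v by auto
        then have "{#T, S#} \<subseteq># P"
          using T v by (simp add: insert_subset_eq_iff in_diff_count)
        moreover have "b S \<le> b T" using T v by simp
        ultimately show ?thesis
          using pair[of T S v] P T v pairwise_minimalD[OF P(2)] by blast
      qed
      then show ?thesis using T P by blast
    qed
    have supp: "\<Union> (set_mset M) = \<Union> (set_mset N)"
      using Suc.prems fin by (metis set_mset_vertex_count subsetD)
    have "M \<noteq> {#}" "N \<noteq> {#}" using Suc by auto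
    obtain T where T: "T \<in># M" "T \<subseteq> \<Union> (set_mset M)" "T \<in> stable_sets G"
        "\<And>v. v \<in> \<Union> (set_mset M) - T \<Longrightarrow> \<exists>u\<in>T. adj G u v \<and> p u < p v"
      using top[OF Suc.prems(1,5) \<open>M \<noteq> {#}\<close>] by blast
    obtain T' where T': "T' \<in># N" "T' \<subseteq> \<Union> (set_mset N)" "T' \<in> stable_sets G"
        "\<And>v. v \<in> \<Union> (set_mset N) - T' \<Longrightarrow> \<exists>u\<in>T'. adj G u v \<and> p u < p v"
      using top[OF Suc.prems(2,6) \<open>N \<noteq> {#}\<close>] by blast
    have "T = T'"
      by (rule greedy_sets_eq[of T G T' "\<Union> (set_mset M)" p]) (use T T' supp st_iff in auto)
    then obtain M' N' where MN: "M = add_mset T M'" "N = add_mset T N'"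
      using T(1) T'(1) by (metis insert_DiffM)
    have "pairwise_minimal G w M'" "pairwise_minimal G w N'"
      using Suc.prems(5,6) by (auto simp: MN elim: pairwise_minimal_mono)
    then have "M' = N'"
      using Suc.prems Suc.hyps(2) by (intro Suc.hyps(1)) (auto simp: MN)
    then show ?case by (simp add: MN)
  qed
  then have "sorting_weight G w"
    unfolding sorting_weight_def by blast
  then show ?thesis by blast
qed


section \<open>Sorting weights of gluings\<close>

lemma subseteq_pair_image_mset:
  assumes "{#A, B#} \<subseteq># image_mset f M"
  obtains S T where "{#S, T#} \<subseteq># M" "f S = A" "f T = B"
proof -
  obtain R where R: "image_mset f M = add_mset A (add_mset B R)"
    using assms by (metis add_mset_add_single subset_mset.le_iff_add union_mset_add_mset_left)
  from msed_map_invR[OF R] obtain N S where N: "M = add_mset S N" "f S = A" "image_mset f N = add_mset B R"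
    by blast
  from msed_map_invR[OF N(3)] obtain N' T where "N = add_mset T N'" "f T = B"
    by blast
  then show thesis using that[of S T] N by simp
qed

lemma filter_mset_vertex_count:
  assumes "\<And>S. S \<in># M \<Longrightarrow> finite S"
  shows "filter_mset (\<lambda>v. v \<in> V) (vertex_count M) = vertex_count (image_mset (\<lambda>S. S \<inter> V) M)"
  using assms
proof (induction M)
  case (add S M)
  have "filter_mset (\<lambda>v. v \<in> V) (mset_set S) = mset_set (S \<inter> V)"
    using add.prems by (subst filter_mset_mset_set) (auto simp: Int_def)
  then show ?case using add by simp
qed simp

text \<open>Sets with at most one element are determined, up to a swap, by their joint count.\<close>

lemma mset_set_pair_cases:
  assumes "finite A" "finite B" "finite C" "finite D"
    and small: "card A \<le> 1" "card B \<le> 1" "card C \<le> 1" "card D \<le> 1"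
    and eq: "mset_set A + mset_set B = mset_set C + mset_set D"
  shows "(A = C \<and> B = D) \<or> (A = D \<and> B = C)"
proof -
  have s: "X = {} \<or> (\<exists>x. X = {x})" if "finite X" "card X \<le> 1" for X :: "'a set"
    using that by (metis card_1_singletonE card_0_eq le_Suc_eq le_zero_eq One_nat_def)
  show ?thesis
    using s[OF assms(1) small(1)] s[OF assms(2) small(2)] s[OF assms(3) small(3)] s[OF assms(4) small(4)] eq
    by (auto simp: add_eq_conv_ex)
qed

lemma uncross_product_sum:
  fixes a b a' b' :: int
  assumes "a < a'" "b' < b"
  shows "a * b + a' * b' < a * b' + a' * b"
proof -
  have "0 < (a' - a) * (b - b')" using assms by simp
  then show ?thesis by (simp add: algebra_simps)
qed

text \<open>A multiset of pairs is determined by its two marginals if, within each class of pairs with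
  the same value of \<open>k1\<close> on the first component, no two pairs are ordered in opposite ways by their
  components. The assumption on \<open>k2\<close> makes the class readable from the second component as well.\<close>

lemma sorted_pairs_unique:
  fixes l1 l2 :: "'b \<Rightarrow> int"
  assumes inj: "inj_on (\<lambda>x. (f1 x, f2 x)) X" "inj_on l1 (f1 ` X)" "inj_on l2 (f2 ` X)"
    and k: "\<And>x. x \<in> X \<Longrightarrow> k1 (f1 x) = k2 (f2 x)"
    and X: "set_mset M \<subseteq> X" "set_mset N \<subseteq> X"
    and eq: "image_mset f1 M = image_mset f1 N" "image_mset f2 M = image_mset f2 N"
    and sorted: "\<And>x y. x \<in># M \<Longrightarrow> y \<in># M \<Longrightarrow> k1 (f1 x) = k1 (f1 y) \<Longrightarrow> l1 (f1 x) < l1 (f1 y) \<Longrightarrow> l2 (f2 x) \<le> l2 (f2 y)"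
      "\<And>x y. x \<in># N \<Longrightarrow> y \<in># N \<Longrightarrow> k1 (f1 x) = k1 (f1 y) \<Longrightarrow> l1 (f1 x) < l1 (f1 y) \<Longrightarrow> l2 (f2 x) \<le> l2 (f2 y)"
  shows "M = N"
  using X eq sorted
proof (induction "size M" arbitrary: M N)
  case 0
  then show ?case by simp
next
  case (Suc n)
  let ?L = "l1 ` f1 ` set_mset M"
  have L: "finite ?L" "?L \<noteq> {}" using Suc.hyps(2) by auto
  obtain x where x: "x \<in># M" "l1 (f1 x) = Max ?L"
    using Max_in[OF L] by auto
  let ?L2 = "(\<lambda>y. l2 (f2 y)) ` {y \<in> set_mset M. k1 (f1 y) = k1 (f1 x)}"
  have L2: "finite ?L2" "?L2 \<noteq> {}" using x by auto
  obtain y where y: "y \<in># M" "k1 (f1 y) = k1 (f1 x)" "l2 (f2 y) = Max ?L2"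
    using Max_in[OF L2] by (smt (verit) imageE mem_Collect_eq)
  have max1: "l1 (f1 z) \<le> l1 (f1 x)" if "z \<in># M" for z
    using x(2) Max_ge[OF L(1), of "l1 (f1 z)"] that by auto
  have max2: "l2 (f2 z) \<le> l2 (f2 y)" if "z \<in># M" "k1 (f1 z) = k1 (f1 x)" for z
    using y(3) Max_ge[OF L2(1), of "l2 (f2 z)"] that by auto
  have top: "\<exists>z\<in>#P. f1 z = f1 x \<and> f2 z = f2 y"
    if P: "set_mset P \<subseteq> X" "image_mset f1 P = image_mset f1 M" "image_mset f2 P = image_mset f2 M"
      and sorted: "\<And>x y. x \<in># P \<Longrightarrow> y \<in># P \<Longrightarrow> k1 (f1 x) = k1 (f1 y) \<Longrightarrow> l1 (f1 x) < l1 (f1 y)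
        \<Longrightarrow> l2 (f2 x) \<le> l2 (f2 y)" for P
  proof -
    have im: "f1 ` set_mset P = f1 ` set_mset M" "f2 ` set_mset P = f2 ` set_mset M"
      using P(2,3) by (metis set_image_mset)+
    obtain s where s: "s \<in># P" "f1 s = f1 x" using im(1) x(1) by (metis imageE imageI)
    obtain t where t: "t \<in># P" "f2 t = f2 y" using im(2) y(1) by (metis imageE imageI)
    obtain t' where t': "t' \<in># M" "f1 t' = f1 t" using im(1) t(1) by (metis imageE imageI)
    obtain s' where s': "s' \<in># M" "f2 s' = f2 s" using im(2) s(1) by (metis imageE imageI)
    have in_X: "s \<in> X" "t \<in> X" "s' \<in> X" "t' \<in> X" "x \<in> X" "y \<in> X"
      using s t s' t' x y P(1) Suc.prems(1) by auto
    have kt: "k1 (f1 t) = k1 (f1 s)"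
      using k[OF in_X(2)] k[OF in_X(6)] t s y by simp
    have ks: "k1 (f1 s') = k1 (f1 x)"
      using k[OF in_X(3)] k[OF in_X(1)] s' s by simp
    consider "l1 (f1 t) = l1 (f1 s)" | "l1 (f1 t) < l1 (f1 s)"
      using max1[OF t'(1)] t' s by fastforce
    then show ?thesis
    proof cases
      case 1
      then have "f1 t = f1 s" using inj(2) in_X by (meson imageI inj_onD)
      then show ?thesis using t s by auto
    next
      case 2
      then have "l2 (f2 t) \<le> l2 (f2 s)" using sorted t s kt by blast
      moreover have "l2 (f2 s) \<le> l2 (f2 y)" using max2[OF s'(1) ks] s' by simp
      ultimately have "f2 s = f2 y" using inj(3) in_X t by (metis dual_order.antisym imageI inj_onD)
      then show ?thesis using s by auto
    qed
  qed
  obtain z where z: "z \<in># M" "f1 z = f1 x" "f2 z = f2 y"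
    using top[of M] Suc.prems(1,5) by blast
  obtain z' where z': "z' \<in># N" "f1 z' = f1 x" "f2 z' = f2 y"
    using top[of N] Suc.prems(2,3,4,6) by metis
  have "z = z'"
    using inj(1) z z' Suc.prems(1,2) by (auto dest!: inj_onD[of _ X z z'])
  then obtain M' N' where MN: "M = add_mset z M'" "N = add_mset z N'"
    using z(1) z'(1) by (metis insert_DiffM)
  have "M' = N'"
    by (rule Suc.hyps(1)) (use Suc.prems Suc.hyps(2) in \<open>auto simp: MN\<close>)
  then show ?case by (simp add: MN)
qed

lemma stable_sets_glued:
  assumes G: "simple_graph H1" "simple_graph H2" and glue: "G = graph_union H1 H2"
  shows "S \<in> stable_sets G \<longleftrightarrow> S \<subseteq> verts H1 \<union> verts H2 \<and>
    S \<inter> verts H1 \<in> stable_sets H1 \<and> S \<inter> verts H2 \<in> stable_sets H2"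
proof -
  have *: "indep S (edges H) \<longleftrightarrow> indep (S \<inter> verts H) (edges H)" if "simple_graph H" for H
  proof -
    have "u \<in> verts H \<and> v \<in> verts H" if "{u, v} \<in> edges H" for u v
      using \<open>simple_graph H\<close> that by (auto simp: simple_graph_def nsets_def)
    then show ?thesis
      unfolding indep_def by (meson IntD1 IntI)
  qed
  have "indep S (edges H1 \<union> edges H2) \<longleftrightarrow> indep S (edges H1) \<and> indep S (edges H2)"
    by (auto simp: indep_def)
  then show ?thesis
    using *[OF G(1)] *[OF G(2)] by (auto simp: glue stable_sets_def graph_union_def)
qed

lemma glue_stable_sets:
  assumes G: "simple_graph H1" "simple_graph H2" and glue: "G = graph_union H1 H2"
    and C: "C \<in> stable_sets H1" and S: "S \<in> stable_sets H2"
    and agree: "C \<inter> verts H2 = S \<inter> verts H1"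
  shows "C \<union> S \<in> stable_sets G" "(C \<union> S) \<inter> verts H1 = C" "(C \<union> S) \<inter> verts H2 = S"
proof -
  have sub: "C \<subseteq> verts H1" "S \<subseteq> verts H2" using C S by (auto simp: stable_sets_def)
  show 1: "(C \<union> S) \<inter> verts H1 = C" and 2: "(C \<union> S) \<inter> verts H2 = S"
    using sub agree by blast+
  show "C \<union> S \<in> stable_sets G"
    unfolding stable_sets_glued[OF G glue] 1 2 using C S sub by auto
qed

text \<open>The weight of a stable set \<open>S\<close> is a large multiple of the total weight of its two restrictions,
  minus a product of numbers enumerating them. The first term makes both restrictions of a pairwise
  minimal multiset pairwise minimal, so they are determined by the fiber. The second term then sorts
  how the two restrictions are matched up, within each class of stable sets having the same
  intersection with the common clique.\<close>

lemma sorting_weight_glued: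
  assumes G1: "simple_graph H1" and G2: "simple_graph H2" and glued: "glued_along_clique G H1 H2"
    and w1: "sorting_weight H1 w1" and w2: "sorting_weight H2 w2"
  shows "\<exists>w. sorting_weight G w"
proof -
  have G_eq: "G = graph_union H1 H2" using glued by (simp add: glued_along_clique_def)
  have G: "simple_graph G" using G1 G2 by (simp add: G_eq simple_graph_union)
  let ?V1 = "verts H1" and ?V2 = "verts H2"
  let ?K = "?V1 \<inter> ?V2" and ?X = "stable_sets G"
  let ?f1 = "\<lambda>S. S \<inter> ?V1" and ?f2 = "\<lambda>S. S \<inter> ?V2"
  note fin = finite_stable_set[OF G] finite_stable_set[OF G1] finite_stable_set[OF G2]
  note st = stable_sets_glued[OF G1 G2 G_eq]
  have r1: "?f1 S \<in> stable_sets H1" and r2: "?f2 S \<in> stable_sets H2" and rV: "S \<subseteq> ?V1 \<union> ?V2"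
    if "S \<in> ?X" for S using that st by blast+
  have K: "{u, v} \<in> edges H1 \<inter> edges H2" if "u \<in> ?K" "v \<in> ?K" "u \<noteq> v" for u v
    using glued that by (auto simp: glued_along_clique_def complete_graph_def clique_def graph_inter_def)
  have small: "card (S \<inter> ?K) \<le> 1" if "S \<in> stable_sets H1 \<or> S \<in> stable_sets H2" for S
  proof -
    have "x = y" if "x \<in> S \<inter> ?K" "y \<in> S \<inter> ?K" for x y
      using that K[of x y] \<open>S \<in> stable_sets H1 \<or> S \<in> stable_sets H2\<close>
      by (auto simp: stable_sets_def indep_def)
    then show ?thesis
      by (metis One_nat_def card.infinite card_le_Suc0_iff_eq zero_le)
  qed
  obtain l1 :: "'a set \<Rightarrow> nat" where l1: "inj_on l1 (stable_sets H1)"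
    using finite_imp_inj_to_nat_seg[OF finite_stable_sets[OF G1]] by blast
  obtain l2 :: "'a set \<Rightarrow> nat" where l2: "inj_on l2 (stable_sets H2)"
    using finite_imp_inj_to_nat_seg[OF finite_stable_sets[OF G2]] by blast
  define \<tau> where "\<tau> S = int (l1 (?f1 S)) * int (l2 (?f2 S))" for S
  obtain B where B: "\<And>S. S \<in> ?X \<Longrightarrow> \<tau> S \<le> B"
    using finite_stable_sets[OF G] by (meson Max_ge finite_imageI imageI)
  have \<tau>_nonneg: "0 \<le> \<tau> S" for S by (simp add: \<tau>_def)
  define L where "L = 2 * B + 1"
  define w where "w S = L * (w1 (?f1 S) + w2 (?f2 S)) - \<tau> S" for S
  \<comment> \<open>The tie-breaking term is dominated by the first one.\<close>
  have dominate: "w C + w D < w S + w T"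
    if "S \<in> ?X" "T \<in> ?X" "C \<in> ?X" "D \<in> ?X"
      "w1 (?f1 C) + w2 (?f2 C) + (w1 (?f1 D) + w2 (?f2 D)) < w1 (?f1 S) + w2 (?f2 S) + (w1 (?f1 T) + w2 (?f2 T))"
    for S T C D
  proof -
    define x y where "x = w1 (?f1 C) + w2 (?f2 C) + (w1 (?f1 D) + w2 (?f2 D))"
      and "y = w1 (?f1 S) + w2 (?f2 S) + (w1 (?f1 T) + w2 (?f2 T))"
    have "0 \<le> B" using B[OF that(1)] \<tau>_nonneg[of S] by simp
    have "L * (y - x) \<ge> L * 1" using that(5) \<open>0 \<le> B\<close> unfolding x_def y_def L_def
      by (intro mult_left_mono) auto
    then have "L * x + L \<le> L * y" by (simp add: algebra_simps)
    moreover have "\<tau> S + \<tau> T \<le> 2 * B" using B[OF that(1)] B[OF that(2)] by simp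
    moreover have "w C + w D = L * x - \<tau> C - \<tau> D" "w S + w T = L * y - \<tau> S - \<tau> T"
      by (simp_all add: w_def x_def y_def algebra_simps)
    ultimately show ?thesis
      using \<tau>_nonneg[of C] \<tau>_nonneg[of D] by (simp add: L_def)
  qed
  have count_eq: "vertex_count {#S, T#} = vertex_count {#C, D#}"
    if "S \<in> ?X" "T \<in> ?X" "C \<in> ?X" "D \<in> ?X"
      "vertex_count {#?f1 S, ?f1 T#} = vertex_count {#?f1 C, ?f1 D#}"
      "vertex_count {#?f2 S, ?f2 T#} = vertex_count {#?f2 C, ?f2 D#}" for S T C D
  proof (rule multiset_eqI)
    fix v
    have fins: "finite S" "finite T" "finite C" "finite D" using that fin by auto
    have "count (vertex_count {#?f1 S, ?f1 T#}) v = count (vertex_count {#?f1 C, ?f1 D#}) v"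
      "count (vertex_count {#?f2 S, ?f2 T#}) v = count (vertex_count {#?f2 C, ?f2 D#}) v"
      using that by simp_all
    then show "count (vertex_count {#S, T#}) v = count (vertex_count {#C, D#}) v"
      using fins rV[OF that(1)] rV[OF that(2)] rV[OF that(3)] rV[OF that(4)]
      by (cases "v \<in> ?V1"; cases "v \<in> ?V2") (auto simp: count_mset_set' split: if_splits)
  qed
  have restrict: "pairwise_minimal H wH (image_mset (\<lambda>S. S \<inter> verts H) M)"
    if M: "set_mset M \<subseteq> ?X" "pairwise_minimal G w M"
      and H: "(H, wH, H', wH') \<in> {(H1, w1, H2, w2), (H2, w2, H1, w1)}" for M H wH H' wH'
    unfolding pairwise_minimal_def
  proof (intro allI impI ballI)
    fix A B C D
    let ?f = "\<lambda>S. S \<inter> verts H" and ?f' = "\<lambda>S. S \<inter> verts H'"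
    assume AB: "{#A, B#} \<subseteq># image_mset ?f M"
      and C: "C \<in> stable_sets H" and D: "D \<in> stable_sets H"
      and eq: "vertex_count {#A, B#} = vertex_count {#C, D#}"
    have HK: "verts H \<inter> verts H' = ?K" using H by auto
    have GH: "simple_graph H" "simple_graph H'" "G = graph_union H H'"
      using H G1 G2 G_eq by (auto simp: graph_union_def Un_commute)
    have wH: "w1 (?f1 S) + w2 (?f2 S) = wH (?f S) + wH' (?f' S)" for S
      using H by auto
    have count_eq': "vertex_count {#S, T#} = vertex_count {#C, D#}"
      if "S \<in> ?X" "T \<in> ?X" "C \<in> ?X" "D \<in> ?X"
        "vertex_count {#?f S, ?f T#} = vertex_count {#?f C, ?f D#}"
        "vertex_count {#?f' S, ?f' T#} = vertex_count {#?f' C, ?f' D#}" for S T C D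
    proof -
      have "vertex_count {#?f1 S, ?f1 T#} = vertex_count {#?f1 C, ?f1 D#} \<and>
          vertex_count {#?f2 S, ?f2 T#} = vertex_count {#?f2 C, ?f2 D#}"
        using H that(5,6) unfolding insert_iff empty_iff prod.inject by metis
      then show ?thesis using count_eq[OF that(1-4)] by blast
    qed
    obtain S T where ST: "{#S, T#} \<subseteq># M" "?f S = A" "?f T = B"
      by (rule subseteq_pair_image_mset[OF AB])
    have "S \<in># M" "T \<in># M" using ST by (auto dest: mset_subset_eqD)
    then have stST: "S \<in> ?X" "T \<in> ?X" using M by auto
    have st': "?f S \<in> stable_sets H" "?f T \<in> stable_sets H" "?f' S \<in> stable_sets H'" "?f' T \<in> stable_sets H'"
      using r1[OF stST(1)] r1[OF stST(2)] r2[OF stST(1)] r2[OF stST(2)] H by auto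
    have key: "wH A + wH B \<le> wH C + wH D"
      if C: "C \<in> stable_sets H" and D: "D \<in> stable_sets H"
        and eq: "vertex_count {#A, B#} = vertex_count {#C, D#}"
        and CD: "A \<inter> ?K = C \<inter> ?K" "B \<inter> ?K = D \<inter> ?K" for C D
    proof (rule ccontr)
      assume less: "\<not> ?thesis"
      have agree: "C \<inter> verts H' = ?f' S \<inter> verts H" "D \<inter> verts H' = ?f' T \<inter> verts H"
        using CD C D ST(2,3) HK by (auto simp: stable_sets_def)
      note g1 = glue_stable_sets[OF GH C st'(3) agree(1)]
      note g2 = glue_stable_sets[OF GH D st'(4) agree(2)]
      have "vertex_count {#S, T#} = vertex_count {#C \<union> ?f' S, D \<union> ?f' T#}"
        by (rule count_eq'[OF stST g1(1) g2(1)])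
          (simp_all only: g1(2,3) g2(2,3) ST(2,3) eq)
      then have "w S + w T \<le> w (C \<union> ?f' S) + w (D \<union> ?f' T)"
        using pairwise_minimalD[OF M(2) ST(1) g1(1) g2(1)] by blast
      moreover have "w (C \<union> ?f' S) + w (D \<union> ?f' T) < w S + w T"
        by (rule dominate[OF stST g1(1) g2(1)], unfold wH g1(2,3) g2(2,3) ST(2,3)) (use less in simp)
      ultimately show False by simp
    qed
    have fins: "finite A" "finite B" "finite C" "finite D"
      using st'(1,2) C D unfolding ST(2,3) by (blast dest: finite_stable_set[OF GH(1)])+
    have "filter_mset (\<lambda>v. v \<in> ?K) (vertex_count {#A, B#}) = filter_mset (\<lambda>v. v \<in> ?K) (vertex_count {#C, D#})"
      using eq by simp
    then have "vertex_count {#A \<inter> ?K, B \<inter> ?K#} = vertex_count {#C \<inter> ?K, D \<inter> ?K#}"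
      using fins by (subst (asm) (1 2) filter_mset_vertex_count) auto
    then have "mset_set (A \<inter> ?K) + mset_set (B \<inter> ?K) = mset_set (C \<inter> ?K) + mset_set (D \<inter> ?K)"
      by simp
    moreover have "card (A \<inter> ?K) \<le> 1" "card (B \<inter> ?K) \<le> 1" "card (C \<inter> ?K) \<le> 1" "card (D \<inter> ?K) \<le> 1"
      using st'(1,2) C D H unfolding ST(2,3) by (blast intro: small)+
    ultimately consider "A \<inter> ?K = C \<inter> ?K" "B \<inter> ?K = D \<inter> ?K" | "A \<inter> ?K = D \<inter> ?K" "B \<inter> ?K = C \<inter> ?K"
      using mset_set_pair_cases[of "A \<inter> ?K" "B \<inter> ?K" "C \<inter> ?K" "D \<inter> ?K"] fins by auto
    then show "wH A + wH B \<le> wH C + wH D"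
    proof cases
      case 1
      then show ?thesis using key C D eq by blast
    next
      case 2
      have "vertex_count {#A, B#} = vertex_count {#D, C#}" using eq by (simp add: add.commute)
      then show ?thesis using key[OF D C _ 2] by (simp add: add.commute)
    qed
  qed
  have uncrossed: "l2 (?f2 S) \<le> l2 (?f2 T)"
    if M: "set_mset M \<subseteq> ?X" "pairwise_minimal G w M"
      and ST: "S \<in># M" "T \<in># M" "?f1 S \<inter> ?K = ?f1 T \<inter> ?K" "l1 (?f1 S) < l1 (?f1 T)" for M S T
  proof (rule ccontr)
    assume less: "\<not> ?thesis"
    have "S \<noteq> T" using ST by auto
    then have sub: "{#S, T#} \<subseteq># M"
      using ST by (simp add: insert_subset_eq_iff in_diff_count)
    have stST: "S \<in> ?X" "T \<in> ?X" using ST M by auto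
    have agree: "?f1 S \<inter> ?V2 = ?f2 T \<inter> ?V1" "?f1 T \<inter> ?V2 = ?f2 S \<inter> ?V1"
      using ST(3) by blast+
    note g1 = glue_stable_sets[OF G1 G2 G_eq r1[OF stST(1)] r2[OF stST(2)] agree(1)]
    note g2 = glue_stable_sets[OF G1 G2 G_eq r1[OF stST(2)] r2[OF stST(1)] agree(2)]
    have "vertex_count {#S, T#} = vertex_count {#?f1 S \<union> ?f2 T, ?f1 T \<union> ?f2 S#}"
      by (rule count_eq[OF stST g1(1) g2(1)], simp_all only: g1(2,3) g2(2,3)) (simp_all add: add.commute)
    then have "w S + w T \<le> w (?f1 S \<union> ?f2 T) + w (?f1 T \<union> ?f2 S)"
      using pairwise_minimalD[OF M(2) sub g1(1) g2(1)] by blast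
    then have "\<tau> (?f1 S \<union> ?f2 T) + \<tau> (?f1 T \<union> ?f2 S) \<le> \<tau> S + \<tau> T"
      unfolding w_def g1(2,3) g2(2,3) by (simp add: algebra_simps)
    moreover have "\<tau> S + \<tau> T < \<tau> (?f1 S \<union> ?f2 T) + \<tau> (?f1 T \<union> ?f2 S)"
      unfolding \<tau>_def g1(2,3) g2(2,3) using ST(4) less by (intro uncross_product_sum) auto
    ultimately show False by simp
  qed
  have "sorting_weight G w"
    unfolding sorting_weight_def
  proof (intro allI impI)
    fix M N
    assume MN: "set_mset M \<subseteq> ?X" "set_mset N \<subseteq> ?X" "size M = size N" "vertex_count M = vertex_count N"
      and min: "pairwise_minimal G w M" "pairwise_minimal G w N"
    have finMN: "finite S" if "S \<in># M \<or> S \<in># N" for S using that MN(1,2) fin by auto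
    have count: "vertex_count (image_mset (\<lambda>S. S \<inter> V) M) = vertex_count (image_mset (\<lambda>S. S \<inter> V) N)" for V
      using MN(4) finMN by (metis filter_mset_vertex_count)
    have 1: "image_mset ?f1 M = image_mset ?f1 N"
      using w1 restrict[OF MN(1) min(1), of H1 w1 H2 w2] restrict[OF MN(2) min(2), of H1 w1 H2 w2]
        count[of ?V1] MN(1-3) r1 unfolding sorting_weight_def
      by (elim allE[of _ "image_mset ?f1 M"] allE[of _ "image_mset ?f1 N"]) auto
    have 2: "image_mset ?f2 M = image_mset ?f2 N"
      using w2 restrict[OF MN(1) min(1), of H2 w2 H1 w1] restrict[OF MN(2) min(2), of H2 w2 H1 w1]
        count[of ?V2] MN(1-3) r2 unfolding sorting_weight_def
      by (elim allE[of _ "image_mset ?f2 M"] allE[of _ "image_mset ?f2 N"]) auto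
    show "M = N"
    proof (rule sorted_pairs_unique[of ?f1 ?f2 ?X "\<lambda>A. int (l1 A)" "\<lambda>A. int (l2 A)" "\<lambda>A. A \<inter> ?K" "\<lambda>A. A \<inter> ?K"])
      show "inj_on (\<lambda>S. (?f1 S, ?f2 S)) ?X"
        using rV by (intro inj_onI) blast
      show "inj_on (\<lambda>A. int (l1 A)) (?f1 ` ?X)"
        using l1 r1 by (fastforce simp: inj_on_def)
      show "inj_on (\<lambda>A. int (l2 A)) (?f2 ` ?X)"
        using l2 r2 by (fastforce simp: inj_on_def)
    qed (use MN 1 2 uncrossed[OF MN(1) min(1)] uncrossed[OF MN(2) min(2)] in auto)
  qed
  then show ?thesis by blast
qed


section \<open>Initial ideals from sorting weights\<close>

text \<open>Monomials in the variables \<open>X\<close> and finite multisets over \<open>X\<close> are identified by the mutually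
  inverse maps \<open>exponents\<close> and \<open>monomial_of\<close>.\<close>

definition exponents :: "('i \<Rightarrow>\<^sub>0 nat) \<Rightarrow> 'i multiset" where
  "exponents u = Abs_multiset (Poly_Mapping.lookup u)"

definition monomial_of :: "'i multiset \<Rightarrow> ('i \<Rightarrow>\<^sub>0 nat)" where
  "monomial_of M = (\<Sum>i\<in>#M. Poly_Mapping.single i 1)"

lemma count_exponents [simp]: "count (exponents u) = Poly_Mapping.lookup u"
proof -
  have "{i. 0 < Poly_Mapping.lookup u i} = Poly_Mapping.keys u"
    by (auto simp: in_keys_iff)
  then show ?thesis
    unfolding exponents_def by (intro count_Abs_multiset) simp
qed

lemma monomial_of_simps [simp]:
  "monomial_of {#} = 0"
  "monomial_of (add_mset i M) = Poly_Mapping.single i 1 + monomial_of M"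
  "monomial_of (M + N) = monomial_of M + monomial_of N"
  by (simp_all add: monomial_of_def)

lemma lookup_monomial_of [simp]: "Poly_Mapping.lookup (monomial_of M) i = count M i"
  by (induction M) (simp_all add: lookup_add lookup_single when_def)

lemma monomial_of_exponents [simp]: "monomial_of (exponents u) = u"
  by (rule poly_mapping_eqI) simp

lemma exponents_monomial_of [simp]: "exponents (monomial_of M) = M"
  by (rule multiset_eqI) simp

lemma exponents_inject [simp]: "exponents u = exponents v \<longleftrightarrow> u = v"
  by (metis monomial_of_exponents)

lemma exponents_add [simp]: "exponents (u + v) = exponents u + exponents v"
  by (rule multiset_eqI) (simp add: lookup_add)

lemma exponents_0 [simp]: "exponents 0 = {#}"
  by (rule multiset_eqI) simp

lemma set_mset_exponents [simp]: "set_mset (exponents u) = Poly_Mapping.keys u"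
  by (auto simp: set_mset_def in_keys_iff)

lemma monomials_iff: "u \<in> monomials X \<longleftrightarrow> set_mset (exponents u) \<subseteq> X"
  by (simp add: monomials_def)

lemma monomial_degree_eq: "monomial_degree u = size (exponents u)"
  by (simp add: monomial_degree_def size_multiset_overloaded_eq)


subsection \<open>Weight orders\<close>

text \<open>Monomials are compared by degree, then by weight, then lexicographically with respect to an
  enumeration \<open>f\<close> of the variables. All three comparisons are read off a single additive key.\<close>

definition weight_key :: "('i \<Rightarrow> nat) \<Rightarrow> ('i \<Rightarrow> int) \<Rightarrow> 'i multiset \<Rightarrow> (nat \<Rightarrow>\<^sub>0 int)" where
  "weight_key f w M = (\<Sum>i\<in>#M. Poly_Mapping.single 0 1 + Poly_Mapping.single 1 (w i) +
     Poly_Mapping.single (f i + 2) 1)"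

definition weight_order :: "('i \<Rightarrow> nat) \<Rightarrow> ('i \<Rightarrow> int) \<Rightarrow> ('i \<Rightarrow>\<^sub>0 nat) \<Rightarrow> ('i \<Rightarrow>\<^sub>0 nat) \<Rightarrow> bool" where
  "weight_order f w u v \<longleftrightarrow> weight_key f w (exponents u) < weight_key f w (exponents v)"

lemma weight_key_add: "weight_key f w (M + N) = weight_key f w M + weight_key f w N"
  by (simp add: weight_key_def)

lemma lookup_weight_key:
  "Poly_Mapping.lookup (weight_key f w M) 0 = int (size M)"
  "Poly_Mapping.lookup (weight_key f w M) 1 = (\<Sum>i\<in>#M. w i)"
  "inj_on f X \<Longrightarrow> set_mset M \<subseteq> X \<Longrightarrow> i \<in> X \<Longrightarrow>
     Poly_Mapping.lookup (weight_key f w M) (f i + 2) = int (count M i)"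
proof -
  have *: "Poly_Mapping.lookup (weight_key f w M) k =
      (\<Sum>i\<in>#M. (if k = 0 then 1 else 0) + (if k = 1 then w i else 0) + (if k = f i + 2 then 1 else 0))" for k
    by (induction M) (auto simp: weight_key_def lookup_add lookup_single lookup_one when_def)
  show "Poly_Mapping.lookup (weight_key f w M) 0 = int (size M)"
    "Poly_Mapping.lookup (weight_key f w M) 1 = (\<Sum>i\<in>#M. w i)"
    unfolding * by (induction M) simp_all
  show "Poly_Mapping.lookup (weight_key f w M) (f i + 2) = int (count M i)"
    if "inj_on f X" "set_mset M \<subseteq> X" "i \<in> X"
    unfolding * using that by (induction M) (auto simp: inj_on_def)
qed

lemma weight_key_inj:
  assumes "inj_on f X" "set_mset M \<subseteq> X" "set_mset N \<subseteq> X" "weight_key f w M = weight_key f w N"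
  shows "M = N"
proof (rule multiset_eqI)
  fix i
  show "count M i = count N i"
  proof (cases "i \<in> X")
    case True
    then show ?thesis using lookup_weight_key(3)[of f X _ i w] assms by (metis of_nat_eq_iff)
  next
    case False
    then show ?thesis using assms by (metis count_eq_zero_iff subsetD)
  qed
qed

lemma weight_key_less_weight:
  assumes "size M = size N" "(\<Sum>i\<in>#M. w i) < (\<Sum>i\<in>#N. w i)"
  shows "weight_key f w M < weight_key f w N"
  unfolding less_poly_mapping.rep_eq
proof (rule less_funI, intro exI conjI allI impI)
  show "Poly_Mapping.lookup (weight_key f w M) 1 < Poly_Mapping.lookup (weight_key f w N) 1"
    using assms(2) by (simp only: lookup_weight_key)
qed (use assms(1) in \<open>simp add: lookup_weight_key\<close>)

lemma weight_key_less_size: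
  assumes "size M < size N"
  shows "weight_key f w M < weight_key f w N"
  unfolding less_poly_mapping.rep_eq
  by (rule less_funI, rule exI[of _ 0]) (use assms in \<open>simp add: lookup_weight_key\<close>)

lemma monomial_order_weight_order:
  assumes "inj_on f X"
  shows "monomial_order X (weight_order f w)"
  unfolding monomial_order_def
proof (intro conjI ballI impI)
  show "irreflp_on (monomials X) (weight_order f w)"
    by (auto simp: irreflp_on_def weight_order_def)
  show "transp_on (monomials X) (weight_order f w)"
    by (auto simp: transp_on_def weight_order_def)
  show "totalp_on (monomials X) (weight_order f w)"
    unfolding totalp_on_def weight_order_def
    using weight_key_inj[OF assms, of "exponents u" "exponents v" w for u v]
    by (metis exponents_inject linorder_neqE monomials_iff)
  show "weight_order f w 0 u" if "u \<noteq> 0" for u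
  proof -
    have "exponents u \<noteq> {#}" using that by (metis exponents_0 exponents_inject)
    then show ?thesis
      unfolding weight_order_def by (intro weight_key_less_size) (simp add: nonempty_has_size)
  qed
  show "weight_order f w (u + t) (v + t)" if "weight_order f w u v" for u v t
    using that by (simp add: weight_order_def weight_key_add)
qed


subsection \<open>Monomial ideals and initial monomials\<close>

text \<open>A set of monomials may be thinned out to a subset whose members divide all others.\<close>

lemma monomial_ideal_eqI:
  fixes X :: "'i set"
  assumes A: "A \<subseteq> monomials X" and M: "M \<subseteq> A"
    and div: "\<And>u. u \<in> A \<Longrightarrow> \<exists>v\<in>M. \<exists>t\<in>monomials X. u = t + v"
  shows "(monomial_ideal X A :: ('i, 'k::field) mpoly set) = monomial_ideal X M"
proof -
  let ?R = "poly_ring X :: ('i, 'k) mpoly ring"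
  let ?x = "\<lambda>u. Poly_Mapping.single u 1 :: ('i, 'k) mpoly"
  interpret cring ?R by (rule cring_poly_ring)
  have carr: "?x ` A \<subseteq> carrier ?R" "?x ` M \<subseteq> carrier ?R"
    using A M by (auto simp: poly_ring_def)
  have I: "ideal (genideal ?R (?x ` M)) ?R"
    using genideal_ideal[OF carr(2)] .
  have "?x ` A \<subseteq> genideal ?R (?x ` M)"
  proof (rule image_subsetI)
    fix u assume "u \<in> A"
    then obtain v t where v: "v \<in> M" "t \<in> monomials X" "u = t + v" using div by blast
    have "?x v \<in> genideal ?R (?x ` M)" using genideal_self[OF carr(2)] v by blast
    moreover have "?x t \<in> carrier ?R" using v by (simp add: poly_ring_def)
    ultimately have "?x t \<otimes>\<^bsub>?R\<^esub> ?x v \<in> genideal ?R (?x ` M)"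
      using ideal.I_l_closed[OF I] by blast
    then show "?x u \<in> genideal ?R (?x ` M)"
      by (simp add: poly_ring_def mult_single v)
  qed
  then have "genideal ?R (?x ` A) \<subseteq> genideal ?R (?x ` M)"
    by (rule genideal_minimal[OF I])
  moreover have "genideal ?R (?x ` M) \<subseteq> genideal ?R (?x ` A)"
    by (rule genideal_minimal[OF genideal_ideal[OF carr(1)]])
      (use genideal_self[OF carr(1)] M in blast)
  ultimately show ?thesis
    by (simp add: monomial_ideal_def)
qed

lemma initial_monomial_eqI:
  assumes "monomial_order X prec" "Poly_Mapping.keys f \<subseteq> monomials X"
    and "u \<in> Poly_Mapping.keys f" "\<And>v. v \<in> Poly_Mapping.keys f \<Longrightarrow> v \<noteq> u \<Longrightarrow> prec v u"
  shows "initial_monomial prec f = u"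
  unfolding initial_monomial_def
proof (rule the_equality)
  fix v
  assume v: "v \<in> Poly_Mapping.keys f \<and> (\<forall>t\<in>Poly_Mapping.keys f. t \<noteq> v \<longrightarrow> prec t v)"
  show "v = u"
  proof (rule ccontr)
    assume "v \<noteq> u"
    then have "prec v u" "prec u v" using v assms by auto
    then show False
      using assms(1-3) v unfolding monomial_order_def irreflp_on_def transp_on_def by blast
  qed
qed (use assms in blast)

lemma initial_monomial_weight_order:
  assumes "inj_on f X" "Poly_Mapping.keys g \<subseteq> monomials X" "g \<noteq> 0"
  shows "initial_monomial (weight_order f w) g \<in> Poly_Mapping.keys g"
    and "v \<in> Poly_Mapping.keys g \<Longrightarrow> v \<noteq> initial_monomial (weight_order f w) g \<Longrightarrow>
      weight_order f w v (initial_monomial (weight_order f w) g)"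
proof -
  let ?k = "\<lambda>u. weight_key f w (exponents u)" and ?P = "weight_order f w"
  have "finite (?k ` Poly_Mapping.keys g)" "?k ` Poly_Mapping.keys g \<noteq> {}"
    using assms(3) by auto
  then obtain u where u: "u \<in> Poly_Mapping.keys g" "?k u = Max (?k ` Poly_Mapping.keys g)"
    using Max_in by (metis (no_types, lifting) imageE)
  have max: "?P v u" if "v \<in> Poly_Mapping.keys g" "v \<noteq> u" for v
  proof -
    have "?k v \<le> ?k u" using u that by simp
    moreover have "?k v \<noteq> ?k u"
      using weight_key_inj[OF assms(1), of "exponents v" "exponents u" w] that u assms(2)
      by (auto simp: monomials_def)
    ultimately show ?thesis by (simp add: weight_order_def)
  qed
  have "initial_monomial ?P g = u"
    by (rule initial_monomial_eqI[OF monomial_order_weight_order[OF assms(1)] assms(2) u(1) max])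
  then show "initial_monomial ?P g \<in> Poly_Mapping.keys g"
    and "v \<in> Poly_Mapping.keys g \<Longrightarrow> v \<noteq> initial_monomial ?P g \<Longrightarrow> ?P v (initial_monomial ?P g)"
    using u max by auto
qed


subsection \<open>The toric ideal\<close>

text \<open>The exponent vector of the image of the monomial \<open>M\<close>.\<close>

definition toric_degree :: "'a set multiset \<Rightarrow> ('a option \<Rightarrow>\<^sub>0 nat)" where
  "toric_degree M = (\<Sum>S\<in>#M. stable_set_monomial S)"

lemma toric_degree_simps [simp]:
  "toric_degree {#} = 0"
  "toric_degree (add_mset S M) = stable_set_monomial S + toric_degree M"
  "toric_degree (M + N) = toric_degree M + toric_degree N"
  by (simp_all add: toric_degree_def)

lemma lookup_stable_set_monomial:
  assumes "finite S"
  shows "Poly_Mapping.lookup (stable_set_monomial S) None = 1"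
    and "Poly_Mapping.lookup (stable_set_monomial S) (Some j) = (if j \<in> S then 1 else 0)"
  using assms by (simp_all add: stable_set_monomial_def lookup_add lookup_sum lookup_single when_def)

lemma lookup_toric_degree:
  assumes "\<And>S. S \<in># M \<Longrightarrow> finite S"
  shows "Poly_Mapping.lookup (toric_degree M) None = size M"
    and "Poly_Mapping.lookup (toric_degree M) (Some j) = count (vertex_count M) j"
  using assms by (induction M) (simp_all add: lookup_add lookup_stable_set_monomial count_mset_set')

lemma toric_degree_eq_iff:
  assumes "\<And>S. S \<in># M \<Longrightarrow> finite S" "\<And>S. S \<in># N \<Longrightarrow> finite S"
  shows "toric_degree M = toric_degree N \<longleftrightarrow> size M = size N \<and> vertex_count M = vertex_count N"
proof
  assume eq: "toric_degree M = toric_degree N"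
  show "size M = size N \<and> vertex_count M = vertex_count N"
    using lookup_toric_degree[OF assms(1)] lookup_toric_degree[OF assms(2)] eq
    by (metis multiset_eqI)
next
  assume eq: "size M = size N \<and> vertex_count M = vertex_count N"
  show "toric_degree M = toric_degree N"
  proof (rule poly_mapping_eqI)
    fix k show "Poly_Mapping.lookup (toric_degree M) k = Poly_Mapping.lookup (toric_degree N) k"
      using lookup_toric_degree[OF assms(1)] lookup_toric_degree[OF assms(2)] eq by (cases k) simp_all
  qed
qed

lemma toric_hom_single:
  "toric_hom (Poly_Mapping.single u (c::'k::field)) = Poly_Mapping.single (toric_degree (exponents u)) c"
proof -
  have "toric_hom (Poly_Mapping.single (monomial_of M) c) = Poly_Mapping.single (toric_degree M) c" for M
  proof (induction M)
    case empty
    then show ?case by (simp add: toric_hom_def poly_subst_const)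
  next
    case (add S M)
    have "Poly_Mapping.single (monomial_of (add_mset S M)) c =
        Poly_Mapping.single (Poly_Mapping.single S 1) 1 * Poly_Mapping.single (monomial_of M) c"
      by (simp add: mult_single)
    then have "toric_hom (Poly_Mapping.single (monomial_of (add_mset S M)) c) =
        toric_hom (Poly_Mapping.single (Poly_Mapping.single S 1) 1) *
        toric_hom (Poly_Mapping.single (monomial_of M) c)"
      by (simp add: toric_hom_def poly_subst_mult)
    then show ?case by (simp only: add toric_hom_var mult_single toric_degree_simps mult_1)
  qed
  from this[of "exponents u"] show ?thesis by simp
qed

lemma lookup_toric_hom:
  "Poly_Mapping.lookup (toric_hom (f :: ('a set, 'k::field) mpoly)) d =
     (\<Sum>u\<in>{u \<in> Poly_Mapping.keys f. toric_degree (exponents u) = d}. Poly_Mapping.lookup f u)"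
proof -
  have "toric_hom f = (\<Sum>u\<in>Poly_Mapping.keys f. toric_hom (Poly_Mapping.single u (Poly_Mapping.lookup f u)))"
    by (subst poly_mapping_sum_single[of f]) (simp only: toric_hom_def poly_subst_sum)
  then show ?thesis
    by (simp add: toric_hom_single lookup_sum lookup_single when_def sum.inter_filter)
qed

lemma toric_ideal_iff:
  "f \<in> toric_ideal G \<longleftrightarrow> Poly_Mapping.keys f \<subseteq> monomials (stable_sets G) \<and> toric_hom f = 0"
  by (simp add: toric_ideal_def a_kernel_def' poly_ring_def)

lemma finite_multisets_of_size: "finite X \<Longrightarrow> finite {M. set_mset M \<subseteq> X \<and> size M = n}"
proof -
  assume "finite X"
  have "{M. set_mset M \<subseteq> X \<and> size M = n} \<subseteq> mset ` {xs. set xs \<subseteq> X \<and> length xs = n}"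
  proof
    fix M assume "M \<in> {M. set_mset M \<subseteq> X \<and> size M = n}"
    moreover obtain xs where "mset xs = M" using ex_mset by blast
    ultimately show "M \<in> mset ` {xs. set xs \<subseteq> X \<and> length xs = n}" by auto
  qed
  then show ?thesis
    by (rule finite_subset) (simp add: finite_lists_length_eq \<open>finite X\<close>)
qed

text \<open>Every multiset of stable sets shares its degree with a pairwise minimal one, which precedes
  it.\<close>

lemma ex_pairwise_minimal:
  assumes G: "simple_graph G" and M: "set_mset M \<subseteq> stable_sets G"
  obtains N where "set_mset N \<subseteq> stable_sets G" "toric_degree N = toric_degree M"
    "pairwise_minimal G w N" "weight_key f w N \<le> weight_key f w M"
proof -
  let ?X = "stable_sets G"
  let ?F = "{N. set_mset N \<subseteq> ?X \<and> toric_degree N = toric_degree M}"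
  note fin = finite_stable_set[OF G]
  have deg: "toric_degree P = toric_degree Q \<longleftrightarrow> size P = size Q \<and> vertex_count P = vertex_count Q"
    if "set_mset P \<subseteq> ?X" "set_mset Q \<subseteq> ?X" for P Q
    by (rule toric_degree_eq_iff) (use that fin in auto)
  have "?F \<subseteq> {N. set_mset N \<subseteq> ?X \<and> size N = size M}" using deg M by blast
  then have "finite ?F" using finite_multisets_of_size[OF finite_stable_sets[OF G]] finite_subset by blast
  then have F: "finite (weight_key f w ` ?F)" "weight_key f w ` ?F \<noteq> {}" using M by auto
  then obtain N where N: "N \<in> ?F" "weight_key f w N = Min (weight_key f w ` ?F)"
    using Min_in by (metis (no_types, lifting) imageE)
  have min: "weight_key f w N \<le> weight_key f w P" if "P \<in> ?F" for P
    using N that F by simp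
  have "pairwise_minimal G w N"
    unfolding pairwise_minimal_def
  proof (intro allI ballI impI, rule ccontr)
    fix A B C D
    assume AB: "{#A, B#} \<subseteq># N" and CD: "C \<in> ?X" "D \<in> ?X"
      and eq: "vertex_count {#A, B#} = vertex_count {#C, D#}" and less: "\<not> w A + w B \<le> w C + w D"
    obtain R where R: "N = {#A, B#} + R" using AB by (metis subset_mset.le_iff_add)
    let ?P = "{#C, D#} + R"
    have P: "set_mset ?P \<subseteq> ?X" using N(1) CD R by auto
    have "toric_degree ?P = toric_degree N"
      using N(1) R P eq by (subst deg) auto
    then have "?P \<in> ?F" using N(1) P by auto
    moreover have "weight_key f w ?P < weight_key f w N"
      by (rule weight_key_less_weight) (use R less in auto)
    ultimately show False using min[of ?P] by simp
  qed
  then show thesis using that N min M by auto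
qed

text \<open>If the initial monomial \<open>u\<close> of \<open>g\<close> were pairwise minimal, it would be the smallest monomial of its
  fiber. But the terms of \<open>g\<close> in that fiber cancel in the image, so \<open>g\<close> has a second, smaller one.\<close>

theorem sorting_weight_imp_squarefree_quadratic:
  assumes G: "simple_graph G" and w: "sorting_weight G w"
  shows "\<exists>prec. monomial_order (stable_sets G) prec \<and>
       squarefree_quadratic (stable_sets G)
         (initial_ideal (stable_sets G) prec (toric_ideal G :: ('a set, 'k::field) mpoly set))"
proof -
  let ?X = "stable_sets G"
  define I :: "('a set, 'k) mpoly set" where "I = toric_ideal G"
  note fin = finite_stable_set[OF G]
  obtain f :: "'a set \<Rightarrow> nat" where f: "inj_on f ?X"
    using finite_imp_inj_to_nat_seg[OF finite_stable_sets[OF G]] by blast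
  let ?P = "weight_order f w"
  have mo: "monomial_order ?X ?P" by (rule monomial_order_weight_order[OF f])
  define Q where "Q = {monomial_of {#A, B#} | A B. A \<in> ?X \<and> B \<in> ?X \<and>
    (\<exists>C\<in>?X. \<exists>D\<in>?X. vertex_count {#A, B#} = vertex_count {#C, D#} \<and> w C + w D < w A + w B)}"
  have mon: "monomial_of M \<in> monomials ?X" if "set_mset M \<subseteq> ?X" for M
    using that by (simp add: monomials_iff)
  have Q_sub: "Q \<subseteq> monomials ?X"
    unfolding Q_def using mon by (auto simp del: monomial_of_simps)
  define J where "J = initial_monomial ?P ` (I - {0})"
  have J_sub: "J \<subseteq> monomials ?X"
  proof
    fix u assume "u \<in> J"
    then obtain g where g: "g \<in> I" "g \<noteq> 0" "u = initial_monomial ?P g"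
      unfolding J_def by blast
    then have "Poly_Mapping.keys g \<subseteq> monomials ?X" by (simp add: I_def toric_ideal_iff)
    then show "u \<in> monomials ?X"
      using initial_monomial_weight_order(1)[OF f _ g(2), of w] g(3) by blast
  qed
  have "Q \<subseteq> J"
  proof
    fix u assume "u \<in> Q"
    then obtain B1 B2 C D where AB: "u = monomial_of {#B1, B2#}" "B1 \<in> ?X" "B2 \<in> ?X"
      and CD: "C \<in> ?X" "D \<in> ?X" "vertex_count {#B1, B2#} = vertex_count {#C, D#}"
        "w C + w D < w B1 + w B2"
      unfolding Q_def by blast
    let ?v = "monomial_of {#C, D#}"
    let ?g = "Poly_Mapping.single u 1 + Poly_Mapping.single ?v (- 1) :: ('a set, 'k) mpoly"
    have less: "?P ?v u"
      unfolding weight_order_def AB exponents_monomial_of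
      by (rule weight_key_less_weight) (use CD in auto)
    then have ne: "u \<noteq> ?v" by (auto simp: weight_order_def)
    have u: "u \<in> monomials ?X" and v: "?v \<in> monomials ?X"
      unfolding AB(1) by (intro mon; use AB CD in simp)+
    have keys: "Poly_Mapping.keys ?g = {u, ?v}"
      using ne by (auto simp: in_keys_iff lookup_add lookup_single when_def simp del: monomial_of_simps split: if_splits)
    have "toric_degree {#B1, B2#} = toric_degree {#C, D#}"
      using AB CD fin by (subst toric_degree_eq_iff) auto
    then have "toric_hom ?g = 0"
      by (simp only: toric_hom_def poly_subst_add)
        (simp only: toric_hom_single[unfolded toric_hom_def] AB exponents_monomial_of
          single_add[symmetric] add.right_inverse single_zero)
    then have "?g \<in> I" unfolding I_def toric_ideal_iff keys using u v by simp
    moreover have "?g \<noteq> 0" using keys by (metis empty_iff insertI1 keys_zero)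
    moreover have "initial_monomial ?P ?g = u"
      by (rule initial_monomial_eqI[OF mo]) (use keys u v less in auto)
    ultimately show "u \<in> J" unfolding J_def by (metis DiffI image_eqI singletonD)
  qed
  moreover have "\<exists>v\<in>Q. \<exists>t\<in>monomials ?X. u = t + v" if "u \<in> J" for u
  proof -
    obtain g where g: "g \<in> I" "g \<noteq> 0" "u = initial_monomial ?P g"
      using \<open>u \<in> J\<close> unfolding J_def by blast
    have keys: "Poly_Mapping.keys g \<subseteq> monomials ?X" and hom: "toric_hom g = 0"
      using g by (auto simp: I_def toric_ideal_iff)
    have u: "u \<in> Poly_Mapping.keys g"
      and max: "\<And>v. v \<in> Poly_Mapping.keys g \<Longrightarrow> v \<noteq> u \<Longrightarrow> ?P v u"
      using initial_monomial_weight_order[OF f keys g(2)] g(3) by auto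
    have uX: "set_mset (exponents u) \<subseteq> ?X" using u keys unfolding monomials_iff[symmetric] by blast
    have "\<not> pairwise_minimal G w (exponents u)"
    proof
      assume min: "pairwise_minimal G w (exponents u)"
      let ?F = "{v \<in> Poly_Mapping.keys g. toric_degree (exponents v) = toric_degree (exponents u)}"
      have "(\<Sum>v\<in>?F. Poly_Mapping.lookup g v) = 0"
        using hom lookup_toric_hom[of g "toric_degree (exponents u)"] by simp
      moreover have "Poly_Mapping.lookup g u \<noteq> 0" using u by (simp add: in_keys_iff)
      ultimately have "?F \<noteq> {u}" by auto
      then obtain v where v: "v \<in> ?F" "v \<noteq> u" using u by auto
      have vX: "set_mset (exponents v) \<subseteq> ?X" using v keys unfolding monomials_iff[symmetric] by blast
      obtain N where N: "set_mset N \<subseteq> ?X" "toric_degree N = toric_degree (exponents v)"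
          "pairwise_minimal G w N" "weight_key f w N \<le> weight_key f w (exponents v)"
        using ex_pairwise_minimal[OF G vX] by blast
      have "toric_degree N = toric_degree (exponents u)" using N(2) v by simp
      then have "size N = size (exponents u)" "vertex_count N = vertex_count (exponents u)"
        using N(1) uX fin by (subst (asm) toric_degree_eq_iff; blast)+
      then have "N = exponents u"
        using w N(1,3) uX min unfolding sorting_weight_def by blast
      moreover have "weight_key f w (exponents v) < weight_key f w (exponents u)"
        using max v unfolding weight_order_def by blast
      ultimately show False using N(4) by simp
    qed
    then obtain B1 B2 C D where AB: "{#B1, B2#} \<subseteq># exponents u" and CD: "C \<in> ?X" "D \<in> ?X"
        "vertex_count {#B1, B2#} = vertex_count {#C, D#}" "w C + w D < w B1 + w B2"
      unfolding pairwise_minimal_def by (auto simp: not_le)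
    obtain R where R: "exponents u = {#B1, B2#} + R" using AB by (metis subset_mset.le_iff_add)
    then have "B1 \<in> ?X" "B2 \<in> ?X" "set_mset R \<subseteq> ?X" using uX by auto
    then have "monomial_of {#B1, B2#} \<in> Q" "monomial_of R \<in> monomials ?X"
      unfolding Q_def using CD mon by blast+
    moreover have "u = monomial_of R + monomial_of {#B1, B2#}"
      using arg_cong[OF R, of monomial_of] by (simp add: add_ac)
    ultimately show ?thesis by blast
  qed
  ultimately have "(monomial_ideal ?X J :: ('a set, 'k) mpoly set) = monomial_ideal ?X Q"
    by (intro monomial_ideal_eqI[OF J_sub])
  then have "initial_ideal ?X ?P I = monomial_ideal ?X Q"
    by (simp add: initial_ideal_def J_def)
  moreover have "squarefree_monomial u \<and> monomial_degree u = 2" if "u \<in> Q" for u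
  proof -
    obtain B1 B2 C D where AB: "u = monomial_of {#B1, B2#}" "B1 \<in> ?X" "B2 \<in> ?X"
      and CD: "C \<in> ?X" "D \<in> ?X" "vertex_count {#B1, B2#} = vertex_count {#C, D#}"
        "w C + w D < w B1 + w B2"
      using \<open>u \<in> Q\<close> unfolding Q_def by blast
    have "B1 \<noteq> B2"
    proof
      assume "B1 = B2"
      \<comment> \<open>The square of a variable is alone in its degree.\<close>
      have "(x \<in> B1 \<longleftrightarrow> x \<in> C) \<and> (x \<in> B1 \<longleftrightarrow> x \<in> D)" for x
      proof -
        have "count (vertex_count {#B1, B2#}) x = count (vertex_count {#C, D#}) x"
          using CD(3) by simp
        then show ?thesis
          using fin[OF AB(2)] fin[OF CD(1)] fin[OF CD(2)] \<open>B1 = B2\<close>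
          by (auto simp: count_mset_set' split: if_splits)
      qed
      then have "B1 = C \<and> B1 = D" by blast
      then show False using CD(4) \<open>B1 = B2\<close> by auto
    qed
    then show ?thesis
      unfolding squarefree_monomial_def monomial_degree_eq AB(1) lookup_monomial_of exponents_monomial_of
      by simp
  qed
  ultimately have "squarefree_quadratic ?X (initial_ideal ?X ?P I)"
    unfolding squarefree_quadratic_def using Q_sub by blast
  then show ?thesis using mo unfolding I_def by blast
qed


section \<open>Gluings and initial ideals of generalized split graphs\<close>

theorem proposition3p5:
  fixes G :: "'a graph"
  assumes "simple_graph G"
    and "generalized_split G"
    and "antihole_free G"
  shows "(\<forall>H\<in>connected_components G. clique_gluing_of_perfectly_orderable H) \<and>
    (\<exists>prec. monomial_order (stable_sets G) prec \<and>
       squarefree_quadratic (stable_sets G)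
         (initial_ideal (stable_sets G) prec (toric_ideal G :: ('a set, 'k::field) mpoly set)))"
proof -
  have induced: "P (induced_subgraph G W)"
    if W: "W \<subseteq> verts G"
      and base: "\<And>(H :: 'a graph) p. simple_graph H \<Longrightarrow> inj_on p (verts H) \<Longrightarrow> obstruction_free H p \<Longrightarrow> P H"
      and glue: "\<And>(H :: 'a graph) H1 H2. P H1 \<Longrightarrow> P H2 \<Longrightarrow> glued_along_clique H H1 H2 \<Longrightarrow> P H" for W P
  proof -
    let ?H = "induced_subgraph G W"
    have H: "simple_graph ?H" "antihole_free ?H"
      using simple_graph_induced_subgraph[OF assms(1) W] antihole_free_induced_subgraph[OF assms(3) W] .
    have W': "W \<subseteq> verts (graph_complement G)" using W by (simp add: graph_complement_def)
    consider "unipolar ?H" | "unipolar (graph_complement ?H)"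
      using assms(2) unipolar_induced_subgraph[OF _ W] unipolar_induced_subgraph[OF _ W']
        graph_complement_induced_subgraph[OF W]
      unfolding generalized_split_def by metis
    then show ?thesis
    proof cases
      case 1
      show ?thesis
        by (rule unipolar_gluing_induct[OF H(1) 1 H(2)]) (fact base, fact glue)
    next
      case 2
      then obtain p where "inj_on p (verts ?H)" "obstruction_free ?H p"
        using counipolar_obstruction_free[OF H(1)] by blast
      then show ?thesis by (rule base[OF H(1)])
    qed
  qed
  have "clique_gluing_of_perfectly_orderable (induced_subgraph G W)" if "W \<subseteq> verts G" for W
    by (rule induced[OF that])
      (auto intro: clique_gluing_of_perfectly_orderable.intros obstruction_free_imp_perfectly_orderable)
  then have "\<forall>H\<in>connected_components G. clique_gluing_of_perfectly_orderable H"
    unfolding connected_components_def by simp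
  moreover have "simple_graph (induced_subgraph G (verts G)) \<and> (\<exists>w. sorting_weight (induced_subgraph G (verts G)) w)"
  proof (rule induced[OF order_refl])
    fix H H1 H2 :: "'a graph"
    assume H1: "simple_graph H1 \<and> (\<exists>w. sorting_weight H1 w)"
      and H2: "simple_graph H2 \<and> (\<exists>w. sorting_weight H2 w)"
      and glued: "glued_along_clique H H1 H2"
    obtain w1 w2 where "sorting_weight H1 w1" "sorting_weight H2 w2" using H1 H2 by blast
    then have "\<exists>w. sorting_weight H w"
      using H1 H2 by (intro sorting_weight_glued[OF _ _ glued]) auto
    moreover have "H = graph_union H1 H2" using glued by (simp add: glued_along_clique_def)
    ultimately show "simple_graph H \<and> (\<exists>w. sorting_weight H w)"
      using simple_graph_union[of H1 H2] H1 H2 by simp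
  qed (use sorting_weight_obstruction_free in blast)
  ultimately show ?thesis
    using sorting_weight_imp_squarefree_quadratic[OF assms(1)] induced_subgraph_verts[OF assms(1)] by auto
qed

end
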